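(* Let $S:=\{z\in\mathbb{C}: |\operatorname{Im} z|<1\}$, let $i(z)=\bar z$ and $h(z)=z+1$. Let $C\subset\mathbb{C}$ be a closed set with $C\subset S$ such that (1) $i(C)=C$ and $h(C)=C$; (2) $C\cap\mathbb{R}\neq\emptyset$; (3) $D:=S\setminus C$ is connected. Then the metric space $(D,k_D)$, where $k_D$ is the Kobayashi distance of $D$, does not satisfy the approaching geodesics property.
   Context: A geodesic ray in a metric space $(X,d)$ is a map $\gamma\colon[0,+\infty)\to X$ with $d(\gamma(s),\gamma(t))=|t-s|$ for all $s,t\ge 0$. Two geodesic rays $\gamma,\sigma$ are asymptotic if $\sup_{t\ge 0}d(\gamma(t),\sigma(t))<+\infty$, and strongly asymptotic if there exists $T\in\mathbb{R}$ such that $\lim_{t\to+\infty}d(\gamma(t),\sigma(t+T))=0$. A proper geodesic metric space $X$ has approaching geodesics (satisfies the approaching geodesics property) if any two asymptotic geodesic rays are strongly asymptotic. For a hyperbolic planar domain $D$ the Kobayashi distance is the distance induced by the complete hyperbolic (Poincaré) metric of $D$, up to the constant normalization. *)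

theory Defs
  imports "HOL-Complex_Analysis.Complex_Analysis"
begin

section \<open>Metric spaces and geodesic rays\<close>

text \<open>A metric space is a carrier \<open>M\<close> with a distance \<open>d\<close>, as in the locale \<^locale>\<open>Metric_space\<close>.\<close>

definition proper_metric_space :: "'a set \<Rightarrow> ('a \<Rightarrow> 'a \<Rightarrow> real) \<Rightarrow> bool" where
  "proper_metric_space M d \<longleftrightarrow>
     Metric_space M d \<and>
     (\<forall>x\<in>M. \<forall>r. compactin (Metric_space.mtopology M d) (Metric_space.mcball M d x r))"

definition geodesic_metric_space :: "'a set \<Rightarrow> ('a \<Rightarrow> 'a \<Rightarrow> real) \<Rightarrow> bool" where
  "geodesic_metric_space M d \<longleftrightarrow>
     Metric_space M d \<and>
     (\<forall>x\<in>M. \<forall>y\<in>M. \<exists>\<gamma>.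
        \<gamma> ` {0..d x y} \<subseteq> M \<and> \<gamma> 0 = x \<and> \<gamma> (d x y) = y \<and>
        (\<forall>s\<in>{0..d x y}. \<forall>t\<in>{0..d x y}. d (\<gamma> s) (\<gamma> t) = \<bar>t - s\<bar>))"

text \<open>A ray is a total function on the reals of which only the values on \<open>[0, \<infinity>)\<close> matter.\<close>

definition geodesic_ray :: "'a set \<Rightarrow> ('a \<Rightarrow> 'a \<Rightarrow> real) \<Rightarrow> (real \<Rightarrow> 'a) \<Rightarrow> bool" where
  "geodesic_ray M d \<gamma> \<longleftrightarrow>
     \<gamma> ` {0..} \<subseteq> M \<and> (\<forall>s\<ge>0. \<forall>t\<ge>0. d (\<gamma> s) (\<gamma> t) = \<bar>t - s\<bar>)"

definition asymptotic_rays :: "('a \<Rightarrow> 'a \<Rightarrow> real) \<Rightarrow> (real \<Rightarrow> 'a) \<Rightarrow> (real \<Rightarrow> 'a) \<Rightarrow> bool" where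
  "asymptotic_rays d \<gamma> \<sigma> \<longleftrightarrow> bdd_above ((\<lambda>t. d (\<gamma> t) (\<sigma> t)) ` {0..})"

text \<open>The shift \<open>T\<close> may be negative; \<open>t + T \<ge> 0\<close> holds for all large \<open>t\<close>, so the limit
  does not depend on the values of \<open>\<sigma>\<close> at negative arguments.\<close>

definition strongly_asymptotic_rays ::
  "('a \<Rightarrow> 'a \<Rightarrow> real) \<Rightarrow> (real \<Rightarrow> 'a) \<Rightarrow> (real \<Rightarrow> 'a) \<Rightarrow> bool" where
  "strongly_asymptotic_rays d \<gamma> \<sigma> \<longleftrightarrow>
     (\<exists>T::real. ((\<lambda>t. d (\<gamma> t) (\<sigma> (t + T))) \<longlongrightarrow> 0) at_top)"

text \<open>This is the condition on rays alone; it is meant for proper geodesic metric spaces, and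
  properness and geodesicity are stated separately. Hence its negation asserts the existence of
  two asymptotic rays that are not strongly asymptotic.\<close>

definition approaching_geodesics :: "'a set \<Rightarrow> ('a \<Rightarrow> 'a \<Rightarrow> real) \<Rightarrow> bool" where
  "approaching_geodesics M d \<longleftrightarrow>
     (\<forall>\<gamma> \<sigma>. geodesic_ray M d \<gamma> \<longrightarrow> geodesic_ray M d \<sigma> \<longrightarrow>
        asymptotic_rays d \<gamma> \<sigma> \<longrightarrow> strongly_asymptotic_rays d \<gamma> \<sigma>)"

section \<open>The Kobayashi distance\<close>

text \<open>Poincare distance of the unit disc, normalized as the distance of the metric
  \<open>|dz| / (1 - |z|\<^sup>2)\<close> of constant curvature \<open>-4\<close>.\<close>

definition poincare_dist :: "complex \<Rightarrow> complex \<Rightarrow> real" where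
  "poincare_dist z w = artanh (cmod ((z - w) / (1 - cnj w * z)))"

text \<open>Kobayashi's definition: the infimum of the lengths of chains of analytic discs in \<open>D\<close>
  from \<open>z\<close> to \<open>w\<close>. The \<open>j\<close>-th disc \<open>f j\<close> joins \<open>p j\<close> to \<open>p (j + 1)\<close>. On a hyperbolic planar
  domain this is the distance of the complete hyperbolic metric of curvature \<open>-4\<close>.\<close>

definition kobayashi_chain_lengths :: "complex set \<Rightarrow> complex \<Rightarrow> complex \<Rightarrow> real set" where
  "kobayashi_chain_lengths D z w =
     {(\<Sum>j<n. poincare_dist (a j) (b j)) | (n::nat) p f a b.
        0 < n \<and> p 0 = z \<and> p n = w \<and>
        (\<forall>j<n. f j holomorphic_on ball 0 1 \<and> f j ` ball 0 1 \<subseteq> D \<and>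
               a j \<in> ball 0 1 \<and> b j \<in> ball 0 1 \<and>
               f j (a j) = p j \<and> f j (b j) = p (Suc j))}"

text \<open>Off \<open>D\<close> there are no chains, whereas \<^locale>\<open>Metric_space\<close> asks for
  nonnegativity and symmetry on the whole type; the distance is therefore set to \<open>0\<close> there.\<close>

definition kobayashi_dist :: "complex set \<Rightarrow> complex \<Rightarrow> complex \<Rightarrow> real" where
  "kobayashi_dist D z w =
     (if z \<in> D \<and> w \<in> D then Inf (kobayashi_chain_lengths D z w) else 0)"

end

theory Submission
  imports Defs
begin

text \<open>
  The two rays that violate the approaching geodesics property are complex conjugates of each
  other. If a geodesic ray \<open>\<gamma>\<close> of \<open>D\<close> stays at a Euclidean distance at least \<open>e > 0\<close> from the
  complement of \<open>D\<close>, then \<open>\<gamma>\<close> and its conjugate \<open>\<sigma>\<close> are asymptotic: by periodicity, the distance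
  from \<open>z\<close> to \<open>cnj z\<close> is bounded on the set of all such points. If they were strongly asymptotic
  with shift \<open>T\<close>, then, the conjugation being an isometry, \<open>\<gamma> t\<close> and \<open>\<gamma> (t + 2 T)\<close> would approach
  each other, so \<open>T = 0\<close> and \<open>\<gamma>\<close> would approach the real axis. But the real part of \<open>\<gamma>\<close> is
  continuous and unbounded, so it passes \<open>Re c + n\<close> for infinitely many integers \<open>n\<close>, where \<open>c\<close> is a
  real point of \<open>C\<close>, and there \<open>\<gamma>\<close> would come arbitrarily close to \<open>c + n\<close>, a point of \<open>C\<close>. This is
  \<open>not_approaching_of_ray_in_core\<close>.

  Such a ray is a limit of geodesic segments from a point \<open>x\<close> to \<open>x + n\<close>. The point is that these
  segments do not come closer and closer to the complement of \<open>D\<close>: near the complement, a unit of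
  hyperbolic length is worth very little Euclidean length (\<open>short_steps_near_omitted\<close>), whereas
  along the translates of \<open>x\<close> one can travel at a fixed price per period (\<open>kd_coarse_bound\<close>). A long
  excursion towards the complement would thus not be length minimizing (\<open>excursions_bounded\<close>,
  \<open>segments_confined\<close>).

  All lower bounds for the distance come from the Schwarz lemma. For every omitted point \<open>c\<close> of the
  closed strip, boundary lines included, a half-plane containing the strip is mapped to the disc
  with \<open>c\<close> going to \<open>0\<close>; the resulting map of \<open>D\<close> to the punctured disc yields a function
  \<open>ln (escape c)\<close> which is Lipschitz for the Kobayashi distance (\<open>kd_escape\<close>). These functions show
  that closed balls are compact. Chains of discs can be cut at any length, so the distance is a
  length distance, and in a proper space this provides geodesic segments (\<open>point_between\<close>,
  \<open>isometry_compactness\<close>).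
\<close>

section \<open>Chains of analytic discs\<close>

text \<open>One link of a chain, normalized: an automorphism of the disc moves the two marked points to
  \<open>0\<close> and to a point \<open>r\<close> of \<open>[0, 1)\<close>. In this form the Schwarz lemma applies directly, and
  cutting a link into two is a matter of cutting the interval \<open>[0, r]\<close>.\<close>

definition disc_step :: "complex set \<Rightarrow> complex \<Rightarrow> complex \<Rightarrow> real \<Rightarrow> bool" where
  "disc_step D z w l \<longleftrightarrow>
     (\<exists>f r. f holomorphic_on ball 0 1 \<and> f ` ball 0 1 \<subseteq> D \<and> 0 \<le> r \<and> r < 1 \<and>
            f 0 = z \<and> f (of_real r) = w \<and> l = artanh r)"

lemma artanh_nonneg:
  fixes r :: real
  assumes "0 \<le> r" "r < 1"
  shows "0 \<le> artanh r"
  using assms by (simp add: artanh_def)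

lemma exp_two_artanh:
  fixes r :: real
  assumes "0 \<le> r" "r < 1"
  shows "exp (2 * artanh r) = (1 + r) / (1 - r)"
  using assms by (simp add: artanh_def)

lemma le_artanh:
  fixes r :: real
  assumes "0 \<le> r" "r < 1"
  shows "r \<le> artanh r"
proof -
  have "artanh 0 - 0 \<le> artanh r - r"
  proof (rule DERIV_nonneg_imp_nondecreasing[where f = "\<lambda>x. artanh x - x"])
    fix x assume x: "0 \<le> x" "x \<le> r"
    have "x\<^sup>2 < 1" using x assms by (simp add: abs_square_less_1)
    then have "1 / (1 - x\<^sup>2) - 1 \<ge> 0" by (simp add: field_simps)
    moreover have "((\<lambda>x. artanh x - x) has_real_derivative (1 / (1 - x\<^sup>2) - 1)) (at x)"
      using x assms by (auto intro!: derivative_eq_intros)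
    ultimately show "\<exists>y. ((\<lambda>x. artanh x - x) has_real_derivative y) (at x) \<and> 0 \<le> y" by blast
  qed (use assms in auto)
  then show ?thesis by simp
qed

text \<open>The automorphism is \<open>\<zeta> \<mapsto> (u \<zeta> + a) / (1 + cnj a u \<zeta>)\<close>; the unimodular factor \<open>u\<close>
  rotates the preimage of \<open>b\<close> onto the positive real axis.\<close>

lemma disc_step_of_disc:
  assumes f: "f holomorphic_on ball 0 1" "f ` ball 0 1 \<subseteq> D"
    and a: "a \<in> ball 0 1" and b: "b \<in> ball 0 1"
  shows "disc_step D (f a) (f b) (poincare_dist a b)"
proof -
  define m where "m = Moebius_function 0 a b"
  define r where "r = cmod m"
  define u where "u = (if m = 0 then 1 else m / of_real r)"
  define \<phi> where "\<phi> = Moebius_function 0 (- a) \<circ> (\<lambda>z. u * z)"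
  have na: "cmod a < 1" "cmod b < 1" using a b by auto
  have r1: "0 \<le> r" "r < 1" unfolding r_def m_def using Moebius_function_norm_lt_1[OF na, of 0] by auto
  have u1: "cmod u = 1" by (auto simp: u_def r_def norm_divide)
  have ur: "u * of_real r = m" by (auto simp: u_def r_def)
  have inb: "(\<lambda>z. u * z) ` ball 0 1 \<subseteq> ball 0 1" using u1 by (auto simp: norm_mult)
  have hol: "\<phi> holomorphic_on ball 0 1" unfolding \<phi>_def
    by (rule holomorphic_on_compose_gen[OF _ Moebius_function_holomorphic inb])
       (use na in \<open>auto intro!: holomorphic_intros\<close>)
  have img: "\<phi> ` ball 0 1 \<subseteq> ball 0 1"
    unfolding \<phi>_def using na u1 by (auto simp: norm_mult intro!: Moebius_function_norm_lt_1)
  have \<phi>0: "\<phi> 0 = a" by (simp add: \<phi>_def Moebius_function_simple)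
  have n1: "1 - cnj a * b \<noteq> 0"
    using na by (metis complex_mod_cnj less_irrefl mult_le_cancel_right1 norm_ge_zero norm_mult norm_one
        not_less eq_iff_diff_eq_0 mult_less_cancel_right1 order_less_trans)
  have n2: "1 - cnj a * a \<noteq> 0"
    using na by (metis complex_mod_cnj less_irrefl norm_ge_zero norm_mult norm_one
        not_less eq_iff_diff_eq_0 mult_less_cancel_right1 order_less_trans)
  have \<phi>r: "\<phi> (of_real r) = b"
  proof -
    have "\<phi> (of_real r) = (m + a) / (1 + cnj a * m)" by (simp add: \<phi>_def Moebius_function_simple ur)
    moreover have "m * (1 - cnj a * b) = b - a"
      using n1 by (simp add: m_def Moebius_function_simple)
    then have "(m + a) * (1 - cnj a * b) = b * (1 - cnj a * a)"
      "(1 + cnj a * m) * (1 - cnj a * b) = 1 - cnj a * a"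
      by algebra+
    then have "(m + a) = b * (1 + cnj a * m)" "1 + cnj a * m \<noteq> 0" using n1 n2
      by (metis (no_types, lifting) ab_semigroup_mult_class.mult_ac(1) mult_cancel_right, force)
    ultimately show ?thesis by simp
  qed
  have "cmod ((a - b) / (1 - cnj b * a)) = r"
  proof -
    have "cmod (1 - cnj b * a) = cmod (cnj (1 - cnj b * a))" by (simp only: complex_mod_cnj)
    also have "cnj (1 - cnj b * a) = 1 - cnj a * b" by (simp add: mult.commute)
    finally show ?thesis by (simp add: r_def m_def Moebius_function_simple norm_divide norm_minus_commute)
  qed
  then have d: "poincare_dist a b = artanh r" by (simp add: poincare_dist_def)
  show ?thesis unfolding disc_step_def
  proof (intro exI[of _ "f \<circ> \<phi>"] exI[of _ r] conjI)
    show "f \<circ> \<phi> holomorphic_on ball 0 1" by (rule holomorphic_on_compose_gen[OF hol f(1) img])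
    show "(f \<circ> \<phi>) ` ball 0 1 \<subseteq> D" using img f(2) by fastforce
  qed (use r1 \<phi>0 \<phi>r d in auto)
qed

lemma disc_step_imp_disc:
  assumes "disc_step D z w l"
  shows "\<exists>f a b. f holomorphic_on ball 0 1 \<and> f ` ball 0 1 \<subseteq> D \<and>
           a \<in> ball 0 1 \<and> b \<in> ball 0 1 \<and> f a = z \<and> f b = w \<and> poincare_dist a b = l"
proof -
  obtain f r where "f holomorphic_on ball 0 1" "f ` ball 0 1 \<subseteq> D" "0 \<le> r" "r < 1"
     "f 0 = z" "f (of_real r) = w" "l = artanh r" using assms unfolding disc_step_def by blast
  then show ?thesis
    by (intro exI[of _ f] exI[of _ 0] exI[of _ "of_real r"]) (auto simp: poincare_dist_def)
qed

lemma disc_step_sym: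
  assumes "disc_step D z w l"
  shows "disc_step D w z l"
proof -
  obtain f a b where f: "f holomorphic_on ball 0 1" "f ` ball 0 1 \<subseteq> D"
     "a \<in> ball 0 1" "b \<in> ball 0 1" "f a = z" "f b = w" "poincare_dist a b = l"
    using disc_step_imp_disc[OF assms] by blast
  have "poincare_dist b a = poincare_dist a b"
  proof -
    have "cmod (1 - cnj a * b) = cmod (cnj (1 - cnj a * b))" by (simp only: complex_mod_cnj)
    also have "cnj (1 - cnj a * b) = 1 - cnj b * a" by (simp add: mult.commute)
    finally show ?thesis by (simp add: poincare_dist_def norm_divide norm_minus_commute)
  qed
  then show ?thesis using disc_step_of_disc[OF f(1,2,4,3)] f by simp
qed

lemma disc_step_in:
  assumes "disc_step D z w l"
  shows "z \<in> D" "w \<in> D" "0 \<le> l"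
  using assms artanh_nonneg unfolding disc_step_def by (force simp: image_subset_iff)+

text \<open>The interval \<open>[0, 1)\<close> is a geodesic of the disc, parametrized by \<open>tanh\<close>.\<close>

lemma artanh_diff:
  fixes x r :: real
  assumes x: "0 \<le> x" and xr: "x \<le> r" and r: "r < 1"
  shows "artanh ((r - x) / (1 - r * x)) = artanh r - artanh x"
proof -
  have "r * x \<le> 1 * x" using x r by (intro mult_right_mono) auto
  then have rx: "0 < 1 - r * x" using xr r by linarith
  define k where "k = 1 - r * x"
  have "1 + (r - x) / k = (k + (r - x)) / k" "1 - (r - x) / k = (k - (r - x)) / k"
    using rx unfolding k_def[symmetric] by (auto simp: add_divide_distrib diff_divide_distrib)
  moreover have "k + (r - x) = (1 + r) * (1 - x)" "k - (r - x) = (1 - r) * (1 + x)"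
    by (simp_all add: k_def algebra_simps)
  ultimately have "(1 + (r - x) / k) / (1 - (r - x) / k) = ((1 + r) * (1 - x)) / ((1 - r) * (1 + x))"
    using rx unfolding k_def[symmetric] by simp
  also have "\<dots> = ((1 + r) / (1 - r)) / ((1 + x) / (1 - x))" by simp
  finally have *: "(1 + (r - x) / k) / (1 - (r - x) / k) = ((1 + r) / (1 - r)) / ((1 + x) / (1 - x))" .
  have "ln (((1 + r) / (1 - r)) / ((1 + x) / (1 - x))) = ln ((1 + r) / (1 - r)) - ln ((1 + x) / (1 - x))"
    using assms by (subst ln_div) auto
  then show ?thesis unfolding artanh_def k_def[symmetric] * by (simp only: diff_divide_distrib)
qed

lemma disc_step_split:
  assumes "disc_step D z w l" "0 \<le> s" "s \<le> l"
  shows "\<exists>m. disc_step D z m s \<and> disc_step D m w (l - s)"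
proof -
  obtain f r where f: "f holomorphic_on ball 0 1" "f ` ball 0 1 \<subseteq> D" "0 \<le> r" "r < 1"
     "f 0 = z" "f (of_real r) = w" "l = artanh r" using assms unfolding disc_step_def by blast
  define x where "x = tanh s"
  have x: "0 \<le> x" "x < 1" "artanh x = s"
    using assms tanh_real_lt_1 by (auto simp: x_def artanh_tanh_real)
  have xr: "x \<le> r"
  proof (rule ccontr)
    assume "\<not> x \<le> r"
    then have "(1 + r) / (1 - r) < (1 + x) / (1 - x)"
      using x f by (intro frac_less2) auto
    then have "exp (2 * artanh r) < exp (2 * artanh x)"
      using exp_two_artanh[OF x(1,2)] exp_two_artanh[OF f(3,4)] by simp
    then show False using x f assms by simp
  qed
  have "r * x \<le> 1 * x" using x f by (intro mult_right_mono) auto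
  then have rx: "r * x < 1" using x by linarith
  have "cmod ((of_real x - of_real r) / (1 - cnj (of_real r) * of_real x)) = cmod (of_real ((x - r) / (1 - r * x)))"
    by simp
  also have "\<dots> = \<bar>(x - r) / (1 - r * x)\<bar>" by (rule norm_of_real)
  also have "\<dots> = (r - x) / (1 - r * x)"
    using xr rx by (simp add: abs_divide)
  finally have d: "poincare_dist (of_real x) (of_real r) = l - s"
    using artanh_diff[OF x(1) xr f(4)] x f by (simp add: poincare_dist_def)
  have "disc_step D z (f (of_real x)) s" unfolding disc_step_def
    using f x by blast
  moreover have "disc_step D (f (of_real x)) w (l - s)"
    using disc_step_of_disc[OF f(1,2), of "of_real x" "of_real r"] x f d by simp
  ultimately show ?thesis by blast
qed

text \<open>Chains with their lengths. The inductive form replaces the four families of data that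
  describe a chain by an induction principle; concatenation, reversal, subdivision and the
  Lipschitz estimates are then inductions.\<close>

inductive disc_chain :: "complex set \<Rightarrow> complex \<Rightarrow> complex \<Rightarrow> real \<Rightarrow> bool" for D where
  single: "disc_step D z w l \<Longrightarrow> disc_chain D z w l"
| cons: "disc_step D z u l \<Longrightarrow> disc_chain D u w L \<Longrightarrow> disc_chain D z w (l + L)"

lemma disc_chain_in:
  assumes "disc_chain D z w L"
  shows "z \<in> D" "w \<in> D" "0 \<le> L"
  using assms by (induction) (auto dest: disc_step_in)

lemma disc_chain_append:
  assumes "disc_chain D z u L" "disc_chain D u w L'"
  shows "disc_chain D z w (L + L')"
  using assms by (induction) (auto intro: disc_chain.intros simp: add.assoc)

lemma disc_chain_sym:
  assumes "disc_chain D z w L"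
  shows "disc_chain D w z L"
  using assms
proof induction
  case (cons z u l w L)
  then show ?case
    using disc_chain_append[OF cons.IH single[OF disc_step_sym[OF cons.hyps(1)]]] by (simp add: add.commute)
qed (auto intro: disc_chain.intros disc_step_sym)

lemma disc_step_refl: "z \<in> D \<Longrightarrow> disc_step D z z 0"
  unfolding disc_step_def by (intro exI[of _ "\<lambda>_. z"] exI[of _ 0]) auto

text \<open>A chain can be cut at any prescribed length. This is the reason why the Kobayashi distance
  is a length distance.\<close>

lemma disc_chain_split:
  assumes "disc_chain D z w L" "0 \<le> s" "s \<le> L"
  shows "\<exists>m. disc_chain D z m s \<and> disc_chain D m w (L - s)"
  using assms
proof (induction arbitrary: s)
  case (single z w l)
  then show ?case by (meson disc_step_split disc_chain.single)
next
  case (cons z u l w L)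
  show ?case
  proof (cases "s \<le> l")
    case True
    then obtain m where m: "disc_step D z m s" "disc_step D m u (l - s)"
      using disc_step_split cons by blast
    have "disc_chain D m w ((l - s) + L)" using m cons by (auto intro: disc_chain.cons)
    moreover have "(l - s) + L = (l + L) - s" by simp
    ultimately show ?thesis using m by (metis disc_chain.single)
  next
    case False
    then obtain m where m: "disc_chain D u m (s - l)" "disc_chain D m w (L - (s - l))"
      using cons.IH[of "s - l"] cons.prems by auto
    have "disc_chain D z m (l + (s - l))" using cons m by (intro disc_chain.cons)
    then show ?thesis using m by (auto simp: algebra_simps)
  qed
qed

lemma kobayashi_chain_lengths_eq: "kobayashi_chain_lengths D z w = {L. disc_chain D z w L}"
proof (intro equalityI subsetI CollectI)
  fix L assume "L \<in> kobayashi_chain_lengths D z w"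
  then obtain n p f a b where n: "0 < n" "p 0 = z" "p n = w" and L: "L = (\<Sum>j<n. poincare_dist (a j) (b j))"
    and *: "\<And>j. j < n \<Longrightarrow> f j holomorphic_on ball 0 1 \<and> f j ` ball 0 1 \<subseteq> D \<and>
               a j \<in> ball 0 1 \<and> b j \<in> ball 0 1 \<and> f j (a j) = p j \<and> f j (b j) = p (Suc j)"
    unfolding kobayashi_chain_lengths_def by blast
  have st: "disc_step D (p j) (p (Suc j)) (poincare_dist (a j) (b j))" if "j < n" for j
    using *[OF that] disc_step_of_disc[of "f j" D "a j" "b j"] by simp
  have "disc_chain D (p 0) (p (Suc k)) (\<Sum>j<Suc k. poincare_dist (a j) (b j))" if "k < n" for k
    using that
  proof (induction k)
    case 0
    then show ?case using st[of 0] by (auto intro: disc_chain.intros)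
  next
    case (Suc k)
    then show ?case
      using disc_chain_append[OF _ single[OF st[of "Suc k"]]] by simp
  qed
  from this[of "n - 1"] show "disc_chain D z w L" using n L by simp
next
  fix L assume "L \<in> {L. disc_chain D z w L}"
  then have "disc_chain D z w L" by simp
  then have "\<exists>(n::nat) p f a b. L = (\<Sum>j<n. poincare_dist (a j) (b j)) \<and> 0 < n \<and> p 0 = z \<and> p n = w \<and>
        (\<forall>j<n. f j holomorphic_on ball 0 1 \<and> f j ` ball 0 1 \<subseteq> D \<and>
               a j \<in> ball 0 1 \<and> b j \<in> ball 0 1 \<and> f j (a j) = p j \<and> f j (b j) = p (Suc j))"
  proof induction
    case (single z w l)
    obtain f a b where f: "f holomorphic_on ball 0 1" "f ` ball 0 1 \<subseteq> D"
     "a \<in> ball 0 1" "b \<in> ball 0 1" "f a = z" "f b = w" "poincare_dist a b = l"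
      using disc_step_imp_disc[OF single] by blast
    show ?case
      by (intro exI[of _ 1] exI[of _ "\<lambda>j. if j = 0 then z else w"] exI[of _ "\<lambda>_. f"] exI[of _ "\<lambda>_. a"] exI[of _ "\<lambda>_. b"])
         (use f in auto)
  next
    case (cons z u l w L)
    obtain f' a' b' where f: "f' holomorphic_on ball 0 1" "f' ` ball 0 1 \<subseteq> D"
     "a' \<in> ball 0 1" "b' \<in> ball 0 1" "f' a' = z" "f' b' = u" "poincare_dist a' b' = l"
      using disc_step_imp_disc[OF cons.hyps(1)] by blast
    obtain n p f a b where n: "L = (\<Sum>j<n. poincare_dist (a j) (b j))" "0 < n" "p 0 = u" "p n = w"
        "\<forall>j<n. f j holomorphic_on ball 0 1 \<and> f j ` ball 0 1 \<subseteq> D \<and>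
               a j \<in> ball 0 1 \<and> b j \<in> ball 0 1 \<and> f j (a j) = p j \<and> f j (b j) = p (Suc j)"
      using cons.IH by blast
    let ?c = "\<lambda>x (g::nat \<Rightarrow> _) j. case j of 0 \<Rightarrow> x | Suc i \<Rightarrow> g i"
    show ?case
    proof (intro exI conjI allI impI)
      show "l + L = (\<Sum>j<Suc n. poincare_dist (?c a' a j) (?c b' b j))"
        using f n by (simp only: sum.lessThan_Suc_shift) simp
      show "?c z p 0 = z" "?c z p (Suc n) = w" using n by auto
      fix j assume "j < Suc n"
      then show "?c f' f j holomorphic_on ball 0 1" "?c f' f j ` ball 0 1 \<subseteq> D"
        "?c a' a j \<in> ball 0 1" "?c b' b j \<in> ball 0 1" "?c f' f j (?c a' a j) = ?c z p j"
        "?c f' f j (?c b' b j) = ?c z p (Suc j)"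
        using f n by (auto split: nat.split)
    qed simp
  qed
  then show "L \<in> kobayashi_chain_lengths D z w" unfolding kobayashi_chain_lengths_def by blast
qed

section \<open>Schwarz--Pick estimates for discs in the strip\<close>

lemma Schwarz_Pick_right_half_plane:
  assumes g: "g holomorphic_on ball 0 1" and pos: "\<And>z. z \<in> ball 0 1 \<Longrightarrow> 0 < Re (g z)"
    and r: "0 \<le> r" "r < 1"
  shows "cmod (g (of_real r) - g 0) \<le> r * cmod (g (of_real r) + cnj (g 0))"
proof -
  define F where "F = (\<lambda>z. (g z - g 0) / (g z + cnj (g 0)))"
  have p0: "0 < Re (g 0)" using pos by simp
  have nz: "g z + cnj (g 0) \<noteq> 0" if "z \<in> ball 0 1" for z
  proof
    assume "g z + cnj (g 0) = 0"
    then have "Re (g z + cnj (g 0)) = 0" by simp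
    then show False using pos[OF that] p0 by simp
  qed
  have "F holomorphic_on ball 0 1" unfolding F_def by (intro holomorphic_intros g nz)
  moreover have "cmod (F z) < 1" if "cmod z < 1" for z
  proof -
    have z: "z \<in> ball 0 1" using that by simp
    have "(cmod (g z - g 0))\<^sup>2 < (cmod (g z + cnj (g 0)))\<^sup>2"
      using mult_pos_pos[OF pos[OF z] p0]
      unfolding cmod_power2 by (simp add: power2_eq_square algebra_simps)
    then have "cmod (g z - g 0) < cmod (g z + cnj (g 0))"
      using norm_ge_zero power_less_imp_less_base by blast
    then show ?thesis using nz[OF z] by (simp add: F_def norm_divide)
  qed
  ultimately have "cmod (F (of_real r)) \<le> cmod (of_real r)"
    using r by (intro Schwarz_Lemma(1)) (auto simp: F_def)
  then show ?thesis using r nz[of "of_real r"] by (simp add: F_def norm_divide divide_le_eq)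
qed

text \<open>Up to a factor, \<open>ln \<circ> Re\<close> is a Busemann function of the right half-plane. The Schwarz--Pick
  inequality bounds the difference of the real parts by \<open>r\<close> times their sum, hence their ratio by
  \<open>(1 + r) / (1 - r) = exp (2 * artanh r)\<close>.\<close>

lemma ln_Re_Lipschitz:
  assumes g: "g holomorphic_on ball 0 1" and pos: "\<And>z. z \<in> ball 0 1 \<Longrightarrow> 0 < Re (g z)"
    and r: "0 \<le> r" "r < 1"
  shows "\<bar>ln (Re (g 0)) - ln (Re (g (of_real r)))\<bar> \<le> 2 * artanh r"
proof -
  define x y where "x = Re (g 0)" and "y = Re (g (of_real r))"
  define v where "v = Im (g (of_real r)) - Im (g 0)"
  have xy: "0 < x" "0 < y" using pos r by (auto simp: x_def y_def)
  have "(cmod (g (of_real r) - g 0))\<^sup>2 \<le> (r * cmod (g (of_real r) + cnj (g 0)))\<^sup>2"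
    using Schwarz_Pick_right_half_plane[OF assms] by (intro power_mono) auto
  then have "(y - x)\<^sup>2 + v\<^sup>2 \<le> r\<^sup>2 * ((y + x)\<^sup>2 + v\<^sup>2)"
    by (simp add: cmod_power2 power_mult_distrib x_def y_def v_def)
  moreover have "r\<^sup>2 * v\<^sup>2 \<le> 1 * v\<^sup>2"
    using r by (intro mult_right_mono) (auto simp: power_le_one)
  ultimately have "(y - x)\<^sup>2 \<le> r\<^sup>2 * (y + x)\<^sup>2" unfolding distrib_left by linarith
  then have "(y - x)\<^sup>2 \<le> (r * (y + x))\<^sup>2" by (simp only: power_mult_distrib)
  then have "\<bar>y - x\<bar> \<le> r * (y + x)"
    using r xy by (metis abs_le_square_iff abs_of_nonneg add_nonneg_nonneg less_imp_le mult_nonneg_nonneg)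
  then have *: "y * (1 - r) \<le> x * (1 + r)" "x * (1 - r) \<le> y * (1 + r)"
    by (auto simp: abs_le_iff algebra_simps)
  have e: "exp (2 * artanh r) = (1 + r) / (1 - r)" using r by (rule exp_two_artanh)
  have "y \<le> x * exp (2 * artanh r)" "x \<le> y * exp (2 * artanh r)"
    unfolding e using * r by (auto simp: le_divide_eq)
  then have "ln y \<le> ln (x * exp (2 * artanh r))" "ln x \<le> ln (y * exp (2 * artanh r))"
    using xy by (auto simp del: ln_mult)
  then show ?thesis using xy by (simp add: ln_mult flip: x_def y_def)
qed

text \<open>The Green function with pole \<open>c\<close> of the half-plane \<open>{z. Im z > Im c - 2}\<close>: the quotient is
  a conformal map of this half-plane onto the unit disc that vanishes at \<open>c\<close>. If \<open>\<bar>Im c\<bar> \<le> 1\<close>, the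
  half-plane contains the strip, so a single formula serves all points \<open>c\<close> of the closed strip.\<close>

definition escape :: "complex \<Rightarrow> complex \<Rightarrow> real" where
  "escape c z = - ln (cmod ((z - c) / (z - c + 4 * \<i>)))"

lemma cmod_less_cmod_shift:
  assumes "-2 < Im u"
  shows "cmod u < cmod (u + 4 * \<i>)" "u + 4 * \<i> \<noteq> 0" "2 \<le> cmod (u + 4 * \<i>)"
proof -
  have "(cmod u)\<^sup>2 < (cmod (u + 4 * \<i>))\<^sup>2"
    using assms unfolding cmod_power2 by (simp add: power2_eq_square algebra_simps)
  then show "cmod u < cmod (u + 4 * \<i>)"
    using norm_ge_zero power_less_imp_less_base by blast
  then show "u + 4 * \<i> \<noteq> 0" by auto
  show "2 \<le> cmod (u + 4 * \<i>)" using assms abs_Im_le_cmod[of "u + 4 * \<i>"] by simp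
qed

text \<open>The boundary lines of the strip count as omitted points. They are treated like the points of
  \<open>C\<close>, so that escaping through the lines and escaping towards \<open>C\<close> are one case.\<close>

definition omitted :: "complex set \<Rightarrow> complex set" where
  "omitted D = {c. \<bar>Im c\<bar> \<le> 1} - D"

lemma escape_pos:
  assumes "D \<subseteq> {z. \<bar>Im z\<bar> < 1}" "c \<in> omitted D" "z \<in> D"
  shows "0 < escape c z"
proof -
  have i: "-2 < Im (z - c)" and n: "z \<noteq> c" using assms by (auto simp: omitted_def)
  have "cmod ((z - c) / (z - c + 4 * \<i>)) < 1"
    using cmod_less_cmod_shift[OF i] by (simp add: norm_divide)
  moreover have "0 < cmod ((z - c) / (z - c + 4 * \<i>))"
    using cmod_less_cmod_shift[OF i] n by simp
  ultimately show ?thesis unfolding escape_def by (simp del: zero_less_norm_iff norm_divide)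
qed

text \<open>A disc in \<open>D\<close> omits \<open>c\<close>; composed with the map of the half-plane onto the disc, it avoids
  \<open>0\<close> and therefore has a logarithm, whose negative takes values in the right half-plane with real
  part \<open>escape c\<close>. In other words, \<open>ln (escape c)\<close> is, up to a factor, the pullback of a
  Busemann function of the punctured disc at its puncture.\<close>

lemma disc_step_escape:
  assumes D: "D \<subseteq> {z. \<bar>Im z\<bar> < 1}" and c: "c \<in> omitted D" and st: "disc_step D z w l"
  shows "\<bar>ln (escape c z) - ln (escape c w)\<bar> \<le> 2 * l"
proof -
  obtain f r where f: "f holomorphic_on ball 0 1" "f ` ball 0 1 \<subseteq> D" and r: "0 \<le> r" "r < 1"
     and e: "f 0 = z" "f (of_real r) = w" "l = artanh r" using st unfolding disc_step_def by blast
  define T where "T = (\<lambda>\<zeta>. (f \<zeta> - c) / (f \<zeta> - c + 4 * \<i>))"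
  have i: "-2 < Im (f \<zeta> - c)" and n: "f \<zeta> - c \<noteq> 0" if "\<zeta> \<in> ball 0 1" for \<zeta>
  proof -
    have "f \<zeta> \<in> D" using f that by blast
    then show "-2 < Im (f \<zeta> - c)" "f \<zeta> - c \<noteq> 0" using D c by (auto simp: omitted_def)
  qed
  have T: "T holomorphic_on ball 0 1" "T \<zeta> \<noteq> 0" if "\<zeta> \<in> ball 0 1" for \<zeta>
    unfolding T_def using cmod_less_cmod_shift(2)[OF i] n that by (auto intro!: holomorphic_intros f)
  have "simply_connected (ball 0 1 :: complex set)" by (simp add: convex_imp_simply_connected)
  then obtain g where g: "g holomorphic_on ball 0 1" "\<And>\<zeta>. \<zeta> \<in> ball 0 1 \<Longrightarrow> T \<zeta> = exp (g \<zeta>)"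
    using simply_connected_eq_holomorphic_log[OF open_ball] T by (metis centre_in_ball zero_less_one)
  have Re: "Re (- g \<zeta>) = escape c (f \<zeta>)" if "\<zeta> \<in> ball 0 1" for \<zeta>
    using g(2)[OF that] by (simp add: T_def escape_def)
  have "\<bar>ln (Re (- g 0)) - ln (Re (- g (of_real r)))\<bar> \<le> 2 * artanh r"
  proof (rule ln_Re_Lipschitz)
    show "(\<lambda>z. - g z) holomorphic_on ball 0 1" by (intro holomorphic_intros g)
    show "0 < Re (- g \<zeta>)" if "\<zeta> \<in> ball 0 1" for \<zeta>
      unfolding Re[OF that] using escape_pos[OF D c] f that by blast
  qed (use r in auto)
  then show ?thesis using Re r e by simp
qed

text \<open>The strip lies in the half-plane \<open>{z. Im z < 1}\<close>, at distance at most \<open>2\<close> from its boundary,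
  so links that are hyperbolically short are short in the plane. The minimum with \<open>1\<close> is taken
  because a half-plane gives no linear bound for long links; it still obeys the triangle
  inequality, which is what summation over a chain needs.\<close>

lemma disc_step_min_dist:
  assumes D: "D \<subseteq> {z. \<bar>Im z\<bar> < 1}" and st: "disc_step D z w l"
  shows "min (cmod (z - w)) 1 \<le> 8 * l"
proof -
  obtain f r where f: "f holomorphic_on ball 0 1" "f ` ball 0 1 \<subseteq> D" and r: "0 \<le> r" "r < 1"
     and e: "f 0 = z" "f (of_real r) = w" "l = artanh r" using st unfolding disc_step_def by blast
  \<comment> \<open>\<open>z \<mapsto> 1 + \<i> z\<close> is an isometry of that half-plane onto the right half-plane\<close>
  define g where "g = (\<lambda>\<zeta>. 1 + \<i> * f \<zeta>)"
  have "g holomorphic_on ball 0 1" unfolding g_def by (intro holomorphic_intros f)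
  moreover have "0 < Re (g \<zeta>)" if "\<zeta> \<in> ball 0 1" for \<zeta>
    using D f that by (force simp: g_def)
  ultimately have *: "cmod (g (of_real r) - g 0) \<le> r * cmod (g (of_real r) + cnj (g 0))"
    using Schwarz_Pick_right_half_plane r by blast
  have gg: "g (of_real r) - g 0 = \<i> * (w - z)" by (simp add: g_def e algebra_simps)
  have "z \<in> D" using disc_step_in[OF st] by simp
  then have "\<bar>Re (g 0)\<bar> \<le> 2" using D by (force simp: g_def e)
  then have "cmod (g 0 + cnj (g 0)) \<le> 4" by (simp add: complex_add_cnj norm_mult)
  moreover have "cmod ((g (of_real r) - g 0) + (g 0 + cnj (g 0)))
      \<le> cmod (g (of_real r) - g 0) + cmod (g 0 + cnj (g 0))" by (rule norm_triangle_ineq)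
  ultimately have "cmod (g (of_real r) + cnj (g 0)) \<le> cmod (g (of_real r) - g 0) + 4"
    by simp
  then have "cmod (z - w) \<le> r * (cmod (z - w) + 4)"
    using * r unfolding gg by (simp add: norm_mult norm_minus_commute)
      (meson mult_left_mono order_trans)
  then have b: "cmod (z - w) * (1 - r) \<le> 4 * r" by (simp add: algebra_simps)
  have a: "r \<le> artanh r" using r by (rule le_artanh)
  show ?thesis
  proof (cases "r \<le> 1/2")
    case True
    have "cmod (z - w) * (1/2) \<le> cmod (z - w) * (1 - r)" using True by (intro mult_left_mono) auto
    then show ?thesis using b a e by linarith
  next
    case False
    then show ?thesis using a e by linarith
  qed
qed

section \<open>The Kobayashi distance of a domain in the strip\<close>

lemma kobayashi_dist_le:
  assumes "disc_chain D z w L"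
  shows "kobayashi_dist D z w \<le> L"
  using disc_chain_in[OF assms] assms
  by (auto simp: kobayashi_dist_def kobayashi_chain_lengths_eq intro!: cInf_lower bdd_belowI[of _ 0] dest: disc_chain_in)

lemma kobayashi_dist_sym: "kobayashi_dist D z w = kobayashi_dist D w z"
proof -
  have "kobayashi_chain_lengths D z w = kobayashi_chain_lengths D w z"
    using disc_chain_sym by (auto simp: kobayashi_chain_lengths_eq)
  then show ?thesis by (simp add: kobayashi_dist_def conj_commute)
qed

lemma disc_chain_in_ball:
  assumes "ball z r \<subseteq> D" "w \<in> ball z r"
  shows "disc_chain D z w (artanh (cmod (w - z) / r))"
proof (rule disc_chain.single)
  have r: "0 < r" using assms(2) by (metis ball_eq_empty empty_iff not_le)
  define f where "f = (\<lambda>\<zeta>. z + of_real r * \<zeta>)"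
  have "f holomorphic_on ball 0 1" unfolding f_def by (intro holomorphic_intros)
  moreover have "f ` ball 0 1 \<subseteq> D"
  proof -
    have "f \<zeta> \<in> ball z r" if "\<zeta> \<in> ball 0 1" for \<zeta>
      using that r by (simp add: f_def dist_norm norm_mult)
    then show ?thesis using assms by blast
  qed
  moreover have "(w - z) / of_real r \<in> ball 0 1" "0 \<in> ball (0::complex) 1"
    using assms r by (auto simp: norm_divide dist_norm norm_minus_commute)
  ultimately have "disc_step D (f 0) (f ((w - z) / of_real r)) (poincare_dist 0 ((w - z) / of_real r))"
    using disc_step_of_disc by blast
  moreover have "poincare_dist 0 ((w - z) / of_real r) = artanh (cmod (w - z) / r)"
    using r by (simp add: poincare_dist_def norm_divide)
  ultimately show "disc_step D z w (artanh (cmod (w - z) / r))"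
    using r by (simp add: f_def)
qed

text \<open>The next four lemmas compare \<open>escape c z\<close> with \<open>cmod (z - c)\<close>, with constants that do not
  depend on \<open>c\<close>. This uniformity is what allows passing to the distance from the whole set of
  omitted points.\<close>

lemma omitted_near:
  assumes c: "-2 < Im (z - c)" "z \<noteq> c" and t: "0 < t" "t \<le> escape c z"
  shows "cmod (z - c) \<le> 4 / (exp t - 1)"
proof -
  have "exp t \<le> exp (escape c z)" using t by simp
  also have "\<dots> = cmod (z - c + 4 * \<i>) / cmod (z - c)"
    using c cmod_less_cmod_shift[OF c(1)] by (simp add: escape_def exp_minus norm_divide)
  finally have "exp t * cmod (z - c) \<le> cmod (z - c + 4 * \<i>)"
    using c by (simp add: le_divide_eq)
  also have "\<dots> \<le> cmod (z - c) + 4"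
    using norm_triangle_ineq[of "z - c" "4 * \<i>"] by (simp add: norm_mult)
  finally have "cmod (z - c) * (exp t - 1) \<le> 4" by (simp add: algebra_simps)
  then show ?thesis using t by (simp add: le_divide_eq)
qed

lemma cmod_eq_exp_escape:
  assumes "-2 < Im (z - c)" "z \<noteq> c"
  shows "cmod (z - c) = exp (- escape c z) * cmod (z - c + 4 * \<i>)"
  using assms cmod_less_cmod_shift[OF assms(1)] by (simp add: escape_def norm_divide)

lemma escape_upper:
  assumes c: "-2 < Im (z - c)" and e: "0 < e" "e \<le> cmod (z - c)"
  shows "escape c z \<le> ln ((e + 4) / e)"
proof -
  let ?a = "cmod (z - c)"
  have "?a \<noteq> 0" using e by linarith
  then have "z \<noteq> c" by auto
  have "escape c z = ln (cmod (z - c + 4 * \<i>) / ?a)"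
    using cmod_less_cmod_shift[OF c] \<open>z \<noteq> c\<close> by (simp add: escape_def norm_divide ln_div)
  also have "\<dots> \<le> ln ((e + 4) / e)"
  proof (rule ln_mono)
    have "cmod (z - c + 4 * \<i>) \<le> ?a + 4"
      using norm_triangle_ineq[of "z - c" "4 * \<i>"] by (simp add: norm_mult)
    then have "cmod (z - c + 4 * \<i>) / ?a \<le> (?a + 4) / ?a"
      by (intro divide_right_mono) auto
    also have "\<dots> = 1 + 4 / ?a" using \<open>?a \<noteq> 0\<close> by (simp add: add_divide_distrib)
    also have "\<dots> \<le> 1 + 4 / e" using e by (simp add: frac_le)
    also have "\<dots> = (e + 4) / e" using e by (simp add: add_divide_distrib)
    finally show "cmod (z - c + 4 * \<i>) / ?a \<le> (e + 4) / e" .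
    show "0 < cmod (z - c + 4 * \<i>) / ?a"
      using cmod_less_cmod_shift[OF c] \<open>z \<noteq> c\<close> by simp
  qed
  finally show ?thesis .
qed

lemma escape_lower:
  assumes c: "-2 < Im (z - c)" "z \<noteq> c" and e: "cmod (z - c) \<le> e"
  shows "ln (2 / e) \<le> escape c z"
proof -
  let ?a = "cmod (z - c)"
  have a: "0 < ?a" using c by simp
  have "ln (2 / e) \<le> ln (cmod (z - c + 4 * \<i>) / ?a)"
  proof (rule ln_mono)
    show "2 / e \<le> cmod (z - c + 4 * \<i>) / ?a"
      using cmod_less_cmod_shift[OF c(1)] e a by (intro frac_le) auto
    show "0 < 2 / e" using order_less_le_trans[OF a e] by simp
  qed
  also have "\<dots> = escape c z"
    using cmod_less_cmod_shift[OF c(1)] c by (simp add: escape_def norm_divide ln_div)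
  finally show ?thesis .
qed

locale strip_domain =
  fixes D :: "complex set"
  assumes open_D: "open D" and connected_D: "connected D" and in_strip: "D \<subseteq> {z. \<bar>Im z\<bar> < 1}"
begin

abbreviation kd :: "complex \<Rightarrow> complex \<Rightarrow> real" where
  "kd \<equiv> kobayashi_dist D"

lemma disc_chain_exists:
  assumes "z \<in> D" "w \<in> D"
  shows "\<exists>L. disc_chain D z w L"
proof (rule connected_equivalence_relation[OF connected_D assms, where R = "\<lambda>z w. \<exists>L. disc_chain D z w L"])
  show "\<exists>L. disc_chain D y x L" if "\<exists>L. disc_chain D x y L" for x y
    using that disc_chain_sym by blast
  show "\<exists>L. disc_chain D x z L" if "\<exists>L. disc_chain D x y L" "\<exists>L. disc_chain D y z L" for x y z
    using that disc_chain_append by blast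
  fix a assume "a \<in> D"
  then obtain r where "0 < r" "ball a r \<subseteq> D" using open_D open_contains_ball by blast
  then show "\<exists>T. openin (top_of_set D) T \<and> a \<in> T \<and> (\<forall>x\<in>T. \<exists>L. disc_chain D a x L)"
    by (intro exI[of _ "ball a r"] conjI ballI exI) (auto simp: openin_open_eq open_D intro: disc_chain_in_ball)
qed

lemma kd_less_imp_chain:
  assumes "z \<in> D" "w \<in> D" "kd z w < e"
  shows "\<exists>L. disc_chain D z w L \<and> kd z w \<le> L \<and> L < e"
proof -
  have "\<exists>L\<in>{L. disc_chain D z w L}. L < e"
    using assms disc_chain_exists[OF assms(1,2)]
    by (intro cInf_lessD) (auto simp: kobayashi_dist_def kobayashi_chain_lengths_eq)
  then show ?thesis using kobayashi_dist_le by blast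
qed

lemma kd_greatest:
  assumes "z \<in> D" "w \<in> D" "\<And>L. disc_chain D z w L \<Longrightarrow> B \<le> L"
  shows "B \<le> kd z w"
  using assms kd_less_imp_chain[OF assms(1,2), of B] by (meson not_le)

lemma kd_nonneg: "0 \<le> kd z w"
proof (cases "z \<in> D \<and> w \<in> D")
  case True
  then show ?thesis using kd_greatest disc_chain_in(3) by blast
qed (auto simp: kobayashi_dist_def)

lemma kd_refl [simp]: "kd z z = 0"
proof (cases "z \<in> D")
  case True
  then show ?thesis
    using kobayashi_dist_le[OF disc_chain.single[OF disc_step_refl[OF True]]] kd_nonneg[of z z] by simp
qed (simp add: kobayashi_dist_def)

lemma kd_triangle:
  assumes "x \<in> D" "y \<in> D" "z \<in> D"
  shows "kd x z \<le> kd x y + kd y z"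
proof (rule field_le_epsilon)
  fix e :: real assume "0 < e"
  then obtain L L' where "disc_chain D x y L" "L < kd x y + e/2" "disc_chain D y z L'" "L' < kd y z + e/2"
    using kd_less_imp_chain[OF assms(1,2), of "kd x y + e/2"] kd_less_imp_chain[OF assms(2,3), of "kd y z + e/2"]
    by auto
  then show "kd x z \<le> kd x y + kd y z + e"
    using kobayashi_dist_le[OF disc_chain_append] by fastforce
qed

text \<open>Within a bounded Kobayashi distance, \<open>escape c\<close> changes at most by a bounded factor. Since
  \<open>escape c z\<close> tends to infinity as \<open>z\<close> tends to \<open>c\<close> and to \<open>0\<close> as \<open>z\<close> tends to infinity, this single estimate keeps
  a ball away from the boundary and bounded.\<close>

lemma kd_escape:
  assumes c: "c \<in> omitted D" and z: "z \<in> D" "w \<in> D"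
  shows "escape c w \<le> exp (2 * kd z w) * escape c z"
proof -
  have "\<bar>ln (escape c z) - ln (escape c w)\<bar> \<le> 2 * L" if "disc_chain D z w L" for L
    using that
  proof induction
    case (cons z u l w L)
    have "\<bar>ln (escape c z) - ln (escape c u)\<bar> \<le> 2 * l" by (rule disc_step_escape[OF in_strip c cons.hyps(1)])
    then show ?case using cons.IH unfolding distrib_left by linarith
  qed (rule disc_step_escape[OF in_strip c])
  then have "\<bar>ln (escape c z) - ln (escape c w)\<bar> / 2 \<le> kd z w"
    by (intro kd_greatest z) force
  then have "\<bar>ln (escape c z) - ln (escape c w)\<bar> \<le> 2 * kd z w" by simp
  then have "ln (escape c w) \<le> 2 * kd z w + ln (escape c z)" by linarith
  then have "exp (ln (escape c w)) \<le> exp (2 * kd z w + ln (escape c z))" by simp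
  then show ?thesis using escape_pos[OF in_strip c] z by (simp add: exp_add)
qed

lemma kd_min_dist:
  assumes z: "z \<in> D" "w \<in> D"
  shows "min (cmod (z - w)) 1 \<le> 8 * kd z w"
proof -
  have "min (cmod (z - w)) 1 \<le> 8 * L" if "disc_chain D z w L" for L
    using that
  proof induction
    case (cons z u l w L)
    have "cmod (z - w) \<le> cmod (z - u) + cmod (u - w)"
      using norm_triangle_ineq[of "z - u" "u - w"] by simp
    then show ?case using disc_step_min_dist[OF in_strip cons.hyps(1)] cons.IH
      disc_step_in(3)[OF cons.hyps(1)] disc_chain_in(3)[OF cons.hyps(2)]
      unfolding distrib_left by linarith
  qed (rule disc_step_min_dist[OF in_strip])
  then have "min (cmod (z - w)) 1 / 8 \<le> kd z w"
    by (intro kd_greatest z) force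
  then show ?thesis by linarith
qed

lemma kd_eq_0: "\<lbrakk>z \<in> D; w \<in> D; kd z w = 0\<rbrakk> \<Longrightarrow> z = w"
  using kd_min_dist[of z w] by (auto simp: min_def split: if_splits)

sublocale kob: Metric_space D kd
  using kd_nonneg kobayashi_dist_sym kd_eq_0 kd_triangle by unfold_locales auto

lemma omitted_ne: "omitted D \<noteq> {}"
proof -
  have "\<i> \<in> omitted D" using in_strip by (auto simp: omitted_def)
  then show ?thesis by blast
qed

lemma closed_omitted: "closed (omitted D)"
proof -
  have "closed ({c. \<bar>Im c\<bar> \<le> 1} - D)"
    by (intro closed_Diff open_D closed_Collect_le continuous_intros)
  then show ?thesis by (simp add: omitted_def)
qed

abbreviation gap :: "complex \<Rightarrow> real" where
  "gap z \<equiv> infdist z (omitted D)"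

lemma gap_pos: "z \<in> D \<Longrightarrow> 0 < gap z"
  using infdist_pos_not_in_closed[OF closed_omitted omitted_ne] by (auto simp: omitted_def)

lemma shift_omitted:
  assumes "c \<in> omitted D" "z \<in> D"
  shows "-2 < Im (z - c)" "z \<noteq> c"
  using assms in_strip by (auto simp: omitted_def)

text \<open>If \<open>z\<close> stays away from all omitted points, so does everything at bounded distance from \<open>z\<close>,
  with an explicit constant that depends only on the two bounds.\<close>

lemma gap_lower_bound:
  assumes z: "z \<in> D" "w \<in> D" and e: "0 < e" "e \<le> gap z" and R: "kd z w \<le> R"
  shows "2 * exp (- (exp (2 * R) * ln ((e + 4) / e))) \<le> gap w"
  unfolding infdist_notempty[OF omitted_ne]
proof (rule cINF_greatest[OF omitted_ne])
  fix c assume c: "c \<in> omitted D"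
  have "e \<le> cmod (z - c)" using infdist_le[OF c, of z] e by (simp add: dist_norm)
  then have "escape c z \<le> ln ((e + 4) / e)" using escape_upper shift_omitted[OF c z(1)] e by blast
  then have "exp (2 * kd z w) * escape c z \<le> exp (2 * R) * ln ((e + 4) / e)"
    using R escape_pos[OF in_strip c z(1)] by (intro mult_mono) auto
  then have "escape c w \<le> exp (2 * R) * ln ((e + 4) / e)" using kd_escape[OF c z] by linarith
  then have "exp (- (exp (2 * R) * ln ((e + 4) / e))) * 2 \<le> exp (- escape c w) * cmod (w - c + 4 * \<i>)"
    using cmod_less_cmod_shift(3)[OF shift_omitted(1)[OF c z(2)]] by (intro mult_mono) auto
  then show "2 * exp (- (exp (2 * R) * ln ((e + 4) / e))) \<le> dist w c"
    using cmod_eq_exp_escape[OF shift_omitted[OF c z(2)]] by (simp add: dist_norm)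
qed

text \<open>If \<open>z\<close> is close to an omitted point \<open>c\<close>, then \<open>escape c z\<close> is huge, hence \<open>escape c w\<close> is still
  large, and \<open>w\<close> is close to the same point \<open>c\<close>. Angular motion around a puncture is covered as
  well, because both points lie close to \<open>c\<close>.\<close>

lemma short_steps_near_omitted:
  assumes \<eta>: "0 < \<eta>"
  shows "\<exists>e>0. \<forall>z\<in>D. \<forall>w\<in>D. gap z < e \<longrightarrow> kd z w \<le> 1 \<longrightarrow> cmod (z - w) \<le> \<eta>"
proof -
  \<comment> \<open>chosen so that a point with \<open>escape c \<ge> t\<close> is within \<open>\<eta> / 2\<close> of \<open>c\<close>\<close>
  define t where "t = ln (1 + 8 / \<eta>)"
  define e where "e = min (\<eta> / 2) (2 * exp (- (exp 2 * t)))"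
  have t: "0 < t" "exp t = 1 + 8 / \<eta>" using \<eta> by (auto simp: t_def add_pos_pos)
  have e: "0 < e" using \<eta> by (simp add: e_def)
  have "cmod (z - w) \<le> \<eta>" if z: "z \<in> D" "w \<in> D" and g: "gap z < e" and k: "kd z w \<le> 1" for z w
  proof -
    obtain c where c: "c \<in> omitted D" "dist z c < e"
      using infdist_attains_inf[OF closed_omitted omitted_ne, of z] g by metis
    have "exp 2 * t = ln (2 / (2 * exp (- (exp 2 * t))))" by (simp add: ln_div)
    also have "\<dots> \<le> ln (2 / e)" using e by (intro ln_mono divide_left_mono) (auto simp: e_def)
    also have "\<dots> \<le> escape c z"
      using c by (intro escape_lower shift_omitted[OF c(1) z(1)]) (simp add: dist_norm)
    also have "\<dots> \<le> exp (2 * kd w z) * escape c w" by (rule kd_escape[OF c(1) z(2,1)])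
    also have "\<dots> \<le> exp 2 * escape c w"
      using k escape_pos[OF in_strip c(1) z(2)] by (intro mult_right_mono) (auto simp: kobayashi_dist_sym[of D w])
    finally have "t \<le> escape c w" by simp
    then have "cmod (w - c) \<le> 4 / (exp t - 1)"
      by (intro omitted_near shift_omitted[OF c(1) z(2)] t)
    also have "\<dots> = \<eta> / 2" using t \<eta> by simp
    finally have "cmod (w - c) \<le> \<eta> / 2" .
    moreover have "cmod (z - c) \<le> \<eta> / 2" using c by (simp add: e_def dist_norm)
    ultimately show ?thesis using norm_triangle_ineq4[of "z - c" "w - c"] by simp
  qed
  then show ?thesis using e by blast
qed

lemma kd_small:
  assumes "x \<in> D" "0 < e"
  shows "\<exists>s>0. ball x s \<subseteq> D \<and> (\<forall>y\<in>ball x s. kd x y < e)"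
proof -
  obtain r where r: "0 < r" "ball x r \<subseteq> D" using assms open_D open_contains_ball by blast
  have "isCont artanh (0::real)" by (rule isCont_artanh) auto
  then obtain s where s: "0 < s" "\<And>t. \<bar>t\<bar> < s \<Longrightarrow> \<bar>artanh t\<bar> < e"
    using assms(2) unfolding continuous_at_eps_delta by (auto simp: dist_norm)
  show ?thesis
  proof (intro exI[of _ "min r (s * r)"] conjI ballI)
    show "0 < min r (s * r)" using r s by simp
    show "ball x (min r (s * r)) \<subseteq> D" using r by auto
    fix y assume y: "y \<in> ball x (min r (s * r))"
    have "kd x y \<le> artanh (cmod (y - x) / r)"
      using disc_chain_in_ball[OF r(2)] y by (intro kobayashi_dist_le) auto
    moreover have "\<bar>artanh (cmod (y - x) / r)\<bar> < e"
      using y r by (intro s) (auto simp: dist_norm norm_minus_commute divide_less_eq)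
    ultimately show "kd x y < e" by linarith
  qed
qed

lemma kd_diff:
  assumes "x \<in> D" "y \<in> D" "x' \<in> D" "y' \<in> D"
  shows "\<bar>kd x' y' - kd x y\<bar> \<le> kd x x' + kd y y'"
  using kd_triangle[of x' x y'] kd_triangle[of x y y'] kd_triangle[of x x' y] kd_triangle[of x' y' y]
    kobayashi_dist_sym[of D x x'] kobayashi_dist_sym[of D y y'] assms by linarith

lemma continuous_on_kd: "continuous_on (D \<times> D) (\<lambda>(x, y). kd x y)"
  unfolding continuous_on_iff
proof (intro ballI allI impI)
  fix p e assume p: "p \<in> D \<times> D" and e: "(0::real) < e"
  obtain x y where xy: "p = (x, y)" "x \<in> D" "y \<in> D" using p by auto
  obtain s s' where s: "0 < s" "\<And>x'. x' \<in> ball x s \<Longrightarrow> kd x x' < e / 2"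
    and s': "0 < s'" "\<And>y'. y' \<in> ball y s' \<Longrightarrow> kd y y' < e / 2"
    using kd_small[of x "e/2"] kd_small[of y "e/2"] xy e by (metis half_gt_zero)
  have "dist (case q of (x, y) \<Rightarrow> kd x y) (case p of (x, y) \<Rightarrow> kd x y) < e"
    if q: "q \<in> D \<times> D" "dist q p < min s s'" for q
  proof -
    obtain x' y' where q': "q = (x', y')" "x' \<in> D" "y' \<in> D" using q by auto
    have "dist x' x < s" "dist y' y < s'"
      using q dist_fst_le[of q p] dist_snd_le[of q p] by (auto simp: q' xy)
    then have "kd x x' < e / 2" "kd y y' < e / 2" using s s' by (auto simp: dist_commute)
    then show ?thesis using kd_diff[of x y x' y'] xy q' by (simp add: dist_norm)
  qed
  then show "\<exists>d>0. \<forall>x'\<in>D \<times> D. dist x' p < d \<longrightarrow>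
        dist (case x' of (x, y) \<Rightarrow> kd x y) (case p of (x, y) \<Rightarrow> kd x y) < e"
    using s(1) s'(1) by (metis min_less_iff_conj)
qed

lemma continuous_on_kd_comp:
  assumes "continuous_on S f" "continuous_on S g" "f ` S \<subseteq> D" "g ` S \<subseteq> D"
  shows "continuous_on S (\<lambda>x. kd (f x) (g x))"
proof -
  have "continuous_on S (\<lambda>x. (case (f x, g x) of (x, y) \<Rightarrow> kd x y))"
    by (rule continuous_on_compose2[OF continuous_on_kd]) (use assms in \<open>auto intro!: continuous_intros\<close>)
  then show ?thesis by simp
qed

text \<open>The bound on the imaginary part is not strict, so that the set is closed in the plane; it
  excludes the points beyond the boundary lines, which are not omitted points and so
  can have a positive gap.\<close>

definition core :: "real \<Rightarrow> complex set" where
  "core e = {z. \<bar>Im z\<bar> \<le> 1 \<and> e \<le> gap z}"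

lemma closed_core: "closed (core e)"
  unfolding core_def by (intro closed_Collect_conj closed_Collect_le continuous_intros)

lemma core_subset: "0 < e \<Longrightarrow> core e \<subseteq> D"
  by (auto simp: core_def omitted_def) (metis DiffI infdist_zero mem_Collect_eq not_le omitted_def)

lemma core_iff: "z \<in> D \<Longrightarrow> z \<in> core e \<longleftrightarrow> e \<le> gap z"
  using in_strip by (auto simp: core_def)

text \<open>Completeness: a ball is closed in the plane since it lies in some \<open>core e\<close>, and bounded since
  the value of \<open>escape \<i>\<close>, which vanishes at infinity, stays above a positive constant.\<close>

lemma compact_kd_cball: "compact {w \<in> D. kd x w \<le> R}" if x: "x \<in> D"
proof -
  define e where "e = 2 * exp (- (exp (2 * R) * ln ((gap x + 4) / gap x)))"
  have e: "0 < e" by (simp add: e_def)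
  have eq: "{w \<in> D. kd x w \<le> R} = {w \<in> core e. kd x w \<le> R}"
    using gap_lower_bound[OF x _ gap_pos[OF x]] core_iff core_subset[OF e] by (auto simp: e_def)
  have "closed (core e \<inter> kd x -` {..R})"
    using core_subset[OF e] x
    by (intro continuous_closed_preimage closed_core closed_atMost continuous_on_kd_comp) auto
  moreover have "core e \<inter> kd x -` {..R} = {w \<in> core e. kd x w \<le> R}" by auto
  ultimately have "closed {w \<in> D. kd x w \<le> R}" unfolding eq by simp
  moreover have "bounded {w \<in> D. kd x w \<le> R}"
  proof -
    have i: "\<i> \<in> omitted D" using in_strip by (auto simp: omitted_def)
    define t where "t = exp (- (2 * R)) * escape \<i> x"
    have t: "0 < t" using escape_pos[OF in_strip i x] by (simp add: t_def)
    have "dist \<i> w \<le> 4 / (exp t - 1)" if w: "w \<in> D" "kd x w \<le> R" for w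
    proof -
      have "escape \<i> x \<le> exp (2 * kd w x) * escape \<i> w" using kd_escape[OF i w(1) x] .
      also have "\<dots> \<le> exp (2 * R) * escape \<i> w"
        using w escape_pos[OF in_strip i w(1)] by (intro mult_right_mono) (auto simp: kobayashi_dist_sym[of D w])
      finally have "t \<le> escape \<i> w" by (simp add: t_def exp_minus field_simps)
      then have "cmod (w - \<i>) \<le> 4 / (exp t - 1)" by (intro omitted_near shift_omitted[OF i w(1)] t)
      then show ?thesis by (simp add: dist_norm norm_minus_commute)
    qed
    then show ?thesis unfolding bounded_def by blast
  qed
  ultimately show ?thesis by (simp add: compact_eq_bounded_closed)
qed

text \<open>Continuity of the identity from the Euclidean topology to the metric topology suffices,
  since Euclidean compactness passes to images.\<close>

lemma proper: "proper_metric_space D kd"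
  unfolding proper_metric_space_def
proof (intro conjI ballI allI kob.Metric_space_axioms)
  fix x r assume x: "x \<in> D"
  have "continuous_map (top_of_set D) kob.mtopology id"
    unfolding kob.continuous_map_to_metric
  proof (intro ballI allI impI)
    fix y e assume y: "y \<in> topspace (top_of_set D)" and e: "(0::real) < e"
    then obtain s where "0 < s" "ball y s \<subseteq> D" "\<forall>w\<in>ball y s. kd y w < e" using kd_small[of y e] by auto
    then show "\<exists>U. openin (top_of_set D) U \<and> y \<in> U \<and> (\<forall>w\<in>U. id w \<in> kob.mball (id y) e)"
      using y by (intro exI[of _ "ball y s"]) (auto simp: openin_open_eq open_D)
  qed
  moreover have "compactin (top_of_set D) {w \<in> D. kd x w \<le> r}"
    using compact_kd_cball[OF x] by (auto simp: compactin_subtopology)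
  ultimately have "compactin kob.mtopology (id ` {w \<in> D. kd x w \<le> r})"
    using image_compactin by blast
  moreover have "kob.mcball x r = {w \<in> D. kd x w \<le> r}" using x by (auto simp: kob.mcball_def)
  ultimately show "compactin kob.mtopology (kob.mcball x r)" by simp
qed

end

section \<open>Geodesic segments and rays\<close>

text \<open>Isometric embeddings of a set of times exist as soon as they exist for its finite subsets, if
  each point is confined to a compact set: by Tychonoff the candidates form a compact set of
  functions, and each isometry condition is closed and involves only two coordinates. Both
  geodesic segments and geodesic rays are obtained from this.\<close>

lemma isometry_compactness:
  fixes A :: "real \<Rightarrow> complex set" and d :: "complex \<Rightarrow> complex \<Rightarrow> real"
  assumes comp: "\<And>t. t \<in> T \<Longrightarrow> compact (A t)"
    and cont: "\<And>s t. s \<in> T \<Longrightarrow> t \<in> T \<Longrightarrow> continuous_on (A s \<times> A t) (\<lambda>(x, y). d x y)"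
    and fin: "\<And>F. finite F \<Longrightarrow> F \<subseteq> T \<Longrightarrow>
        \<exists>\<gamma>. (\<forall>t\<in>F. \<gamma> t \<in> A t) \<and> (\<forall>s\<in>F. \<forall>t\<in>F. d (\<gamma> s) (\<gamma> t) = \<bar>t - s\<bar>)"
  shows "\<exists>\<gamma>. (\<forall>t\<in>T. \<gamma> t \<in> A t) \<and> (\<forall>s\<in>T. \<forall>t\<in>T. d (\<gamma> s) (\<gamma> t) = \<bar>t - s\<bar>)"
proof -
  define A' where "A' t = (if t \<in> T then A t else {0})" for t
  define K where "K = PiE UNIV A'"
  define P where "P s t = {p \<in> A s \<times> A t. (case p of (x, y) \<Rightarrow> d x y) = \<bar>t - s\<bar>}" for s t
  define E where "E = (\<lambda>(s, t). (\<lambda>\<gamma> :: real \<Rightarrow> complex. (\<gamma> s, \<gamma> t)) -` P s t)"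
  have K: "compact K"
  proof -
    have "compactin (product_topology (\<lambda>_. euclidean) UNIV) K"
      unfolding K_def compactin_PiE using comp by (auto simp: A'_def)
    then show ?thesis by (simp add: euclidean_product_topology)
  qed
  have ne: "A t \<noteq> {}" if "t \<in> T" for t using fin[of "{t}"] that by auto
  have "K \<inter> (\<Inter>i\<in>T \<times> T. E i) \<noteq> {}"
  proof (rule compact_imp_fip_image[OF K])
    fix i assume "i \<in> T \<times> T"
    then obtain s t where i: "i = (s, t)" "s \<in> T" "t \<in> T" by auto
    have "closed (P s t)" unfolding P_def
      using continuous_closed_preimage_constant[OF cont[OF i(2,3)], of "\<bar>t - s\<bar>"] comp i
      by (simp add: compact_imp_closed closed_Times)
    moreover have "continuous_on UNIV (\<lambda>\<gamma> :: real \<Rightarrow> complex. (\<gamma> s, \<gamma> t))"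
      by (intro continuous_on_Pair continuous_on_product_coordinates)
    ultimately show "closed (E i)" by (simp add: E_def i closed_vimage)
  next
    fix I assume I: "finite I" "I \<subseteq> T \<times> T"
    define F where "F = fst ` I \<union> snd ` I"
    have "finite F" "F \<subseteq> T" using I by (auto simp: F_def)
    then obtain \<gamma> where \<gamma>: "\<forall>t\<in>F. \<gamma> t \<in> A t" "\<forall>s\<in>F. \<forall>t\<in>F. d (\<gamma> s) (\<gamma> t) = \<bar>t - s\<bar>"
      using fin by blast
    define \<gamma>' where "\<gamma>' t = (if t \<in> F then \<gamma> t else SOME x. x \<in> A' t)" for t
    have "\<gamma>' t \<in> A' t" for t
    proof (cases "t \<in> F")
      case True
      then show ?thesis using \<gamma> \<open>F \<subseteq> T\<close> by (auto simp: \<gamma>'_def A'_def)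
    next
      case False
      have "\<exists>x. x \<in> A' t" using ne by (auto simp: A'_def)
      then show ?thesis using False someI_ex[OF \<open>\<exists>x. x \<in> A' t\<close>] by (simp add: \<gamma>'_def)
    qed
    then have "\<gamma>' \<in> K" by (auto simp: K_def)
    moreover have "\<gamma>' \<in> E i" if "i \<in> I" for i
    proof -
      obtain s t where i: "i = (s, t)" by fastforce
      then have "s \<in> F" "t \<in> F" using that by (force simp: F_def)+
      then show ?thesis using \<gamma> by (simp add: E_def P_def i \<gamma>'_def)
    qed
    ultimately show "K \<inter> (\<Inter>i\<in>I. E i) \<noteq> {}" by blast
  qed
  then obtain \<gamma> where \<gamma>: "\<And>i. i \<in> T \<times> T \<Longrightarrow> \<gamma> \<in> E i" by blast
  have "(\<gamma> s, \<gamma> t) \<in> P s t" if "s \<in> T" "t \<in> T" for s t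
    using \<gamma>[of "(s, t)"] that by (simp add: E_def)
  then show ?thesis by (intro exI[of _ \<gamma>]) (auto simp: P_def)
qed

context strip_domain
begin

text \<open>Cutting a nearly optimal chain gives points that lie nearly between \<open>z\<close> and \<open>w\<close>; compactness of
  balls turns them into an exact point.\<close>

lemma point_between:
  assumes z: "z \<in> D" "w \<in> D" and s: "0 \<le> s" "s \<le> kd z w"
  shows "\<exists>m\<in>D. kd z m = s \<and> kd m w = kd z w - s"
proof -
  define K where "K = {m \<in> D. kd z m \<le> kd z w + 1}"
  \<comment> \<open>\<open>F\<close> measures by how much a point fails to be at distance \<open>s\<close> along the way\<close>
  define F where "F m = max (kd z m - s) (kd m w - (kd z w - s))" for m
  have "compact K" unfolding K_def by (rule compact_kd_cball[OF z(1)])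
  moreover have "K \<noteq> {}" using z kd_nonneg[of z w] by (auto simp: K_def intro!: exI[of _ z])
  moreover have "continuous_on K F" unfolding F_def
    by (intro continuous_intros continuous_on_kd_comp) (use z in \<open>auto simp: K_def\<close>)
  ultimately obtain m0 where m0: "m0 \<in> K" "\<And>m. m \<in> K \<Longrightarrow> F m0 \<le> F m"
    using continuous_attains_inf by metis
  have "F m0 \<le> 0"
  proof (rule field_le_epsilon)
    fix e :: real assume e: "0 < e"
    obtain L where L: "disc_chain D z w L" "kd z w \<le> L" "L < kd z w + min e 1"
      using kd_less_imp_chain[OF z, of "kd z w + min e 1"] e by auto
    obtain m where m: "disc_chain D z m s" "disc_chain D m w (L - s)"
      using disc_chain_split[OF L(1) s(1)] s L by auto
    have "kd z m \<le> s" "kd m w \<le> L - s" using m kobayashi_dist_le by auto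
    then have "m \<in> K" "F m \<le> e" using s L e disc_chain_in[OF m(1)] by (auto simp: K_def F_def)
    then show "F m0 \<le> 0 + e" using m0 by force
  qed
  then have "kd z m0 \<le> s" "kd m0 w \<le> kd z w - s" by (auto simp: F_def)
  moreover have "m0 \<in> D" using m0 by (simp add: K_def)
  ultimately show ?thesis using kd_triangle[of z m0 w] z by (intro bexI[of _ m0]) auto
qed

text \<open>The points are placed in the order of their times, each one between its predecessor and \<open>w\<close>.
  Carrying the distances to \<open>z\<close> and \<open>w\<close> along makes all other distances exact.\<close>

lemma finite_points_between:
  assumes z: "z \<in> D" "w \<in> D" and F: "finite F" "F \<subseteq> {0..kd z w}"
  shows "\<exists>\<gamma>. (\<forall>t\<in>F. \<gamma> t \<in> D \<and> kd z (\<gamma> t) = t \<and> kd (\<gamma> t) w = kd z w - t) \<and>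
             (\<forall>s\<in>F. \<forall>t\<in>F. kd (\<gamma> s) (\<gamma> t) = \<bar>t - s\<bar>)"
  using F
proof (induction F rule: finite_linorder_max_induct)
  case empty
  then show ?case by simp
next
  case (insert b A)
  have "A \<subseteq> {0..kd z w}" using insert.prems by auto
  from insert.IH[OF this] obtain \<gamma>
    where g1: "\<And>t. t \<in> A \<Longrightarrow> \<gamma> t \<in> D \<and> kd z (\<gamma> t) = t \<and> kd (\<gamma> t) w = kd z w - t"
      and g2: "\<And>s t. s \<in> A \<Longrightarrow> t \<in> A \<Longrightarrow> kd (\<gamma> s) (\<gamma> t) = \<bar>t - s\<bar>"
    by blast
  have b: "0 \<le> b" "b \<le> kd z w" using insert.prems by auto
  have "\<exists>m\<in>D. kd z m = b \<and> kd m w = kd z w - b \<and> (\<forall>s\<in>A. kd (\<gamma> s) m = b - s)"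
  proof (cases "A = {}")
    case True
    then show ?thesis using point_between[OF z b] by auto
  next
    case False
    define a where "a = Max A"
    have a: "a \<in> A" "a < b" "\<And>s. s \<in> A \<Longrightarrow> s \<le> a"
      using insert.hyps False by (auto simp: a_def)
    have ga: "\<gamma> a \<in> D" "kd z (\<gamma> a) = a" "kd (\<gamma> a) w = kd z w - a" using g1[OF a(1)] by auto
    obtain m where m: "m \<in> D" "kd (\<gamma> a) m = b - a" "kd m w = kd z w - b"
      using point_between[OF ga(1) z(2), of "b - a"] a b ga by auto
    have "kd z m = b"
      using kd_triangle[OF z(1) ga(1) m(1)] kd_triangle[OF z(1) m(1) z(2)] ga m by linarith
    moreover have "kd (\<gamma> s) m = b - s" if s: "s \<in> A" for s
    proof -
      have "kd (\<gamma> s) (\<gamma> a) = a - s" using g2[OF s a(1)] a(3)[OF s] by simp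
      moreover have "\<gamma> s \<in> D" "kd (\<gamma> s) w = kd z w - s" using g1[OF s] by auto
      ultimately show ?thesis
        using kd_triangle[of "\<gamma> s" "\<gamma> a" m] kd_triangle[of "\<gamma> s" m w] ga m z by linarith
    qed
    ultimately show ?thesis using m by blast
  qed
  then obtain m where m: "m \<in> D" "kd z m = b" "kd m w = kd z w - b" "\<And>s. s \<in> A \<Longrightarrow> kd (\<gamma> s) m = b - s"
    by blast
  have "b \<notin> A" using insert.hyps by auto
  then have *: "(\<gamma>(b := m)) t = \<gamma> t" if "t \<in> A" for t using that by auto
  show ?case
    using m g1 g2 insert.hyps * kobayashi_dist_sym[of D m]
    by (intro exI[of _ "\<gamma>(b := m)"]) (auto simp: less_imp_le)
qed

lemma geodesic_segment_exists:
  assumes z: "z \<in> D" "w \<in> D"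
  shows "\<exists>\<gamma>. \<gamma> ` {0..kd z w} \<subseteq> D \<and> \<gamma> 0 = z \<and> \<gamma> (kd z w) = w \<and>
            (\<forall>s\<in>{0..kd z w}. \<forall>t\<in>{0..kd z w}. kd (\<gamma> s) (\<gamma> t) = \<bar>t - s\<bar>)"
proof -
  define A where "A t = (if t = kd z w then {w} else {m \<in> D. kd z m \<le> t})" for t
  have AD: "A t \<subseteq> D" for t using z by (auto simp: A_def)
  have "\<exists>\<gamma>. (\<forall>t\<in>{0..kd z w}. \<gamma> t \<in> A t) \<and>
     (\<forall>s\<in>{0..kd z w}. \<forall>t\<in>{0..kd z w}. kd (\<gamma> s) (\<gamma> t) = \<bar>t - s\<bar>)"
  proof (rule isometry_compactness)
    show "compact (A t)" for t using compact_kd_cball[OF z(1)] by (auto simp: A_def)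
    show "continuous_on (A s \<times> A t) (\<lambda>(x, y). kd x y)" for s t
      using AD by (intro continuous_on_subset[OF continuous_on_kd]) auto
    fix F assume "finite F" "F \<subseteq> {0..kd z w}"
    then obtain \<gamma> where g: "\<forall>t\<in>F. \<gamma> t \<in> D \<and> kd z (\<gamma> t) = t \<and> kd (\<gamma> t) w = kd z w - t"
       "\<forall>s\<in>F. \<forall>t\<in>F. kd (\<gamma> s) (\<gamma> t) = \<bar>t - s\<bar>"
      using finite_points_between[OF z] by blast
    have "\<gamma> t \<in> A t" if "t \<in> F" for t
      using g(1) that kd_eq_0[of "\<gamma> t" w] z by (auto simp: A_def)
    then show "\<exists>\<gamma>. (\<forall>t\<in>F. \<gamma> t \<in> A t) \<and> (\<forall>s\<in>F. \<forall>t\<in>F. kd (\<gamma> s) (\<gamma> t) = \<bar>t - s\<bar>)"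
      using g(2) by blast
  qed
  then obtain \<gamma> where \<gamma>: "\<And>t. t \<in> {0..kd z w} \<Longrightarrow> \<gamma> t \<in> A t"
     "\<And>s t. s \<in> {0..kd z w} \<Longrightarrow> t \<in> {0..kd z w} \<Longrightarrow> kd (\<gamma> s) (\<gamma> t) = \<bar>t - s\<bar>" by blast
  have "\<gamma> (kd z w) = w" using \<gamma>(1)[of "kd z w"] kd_nonneg[of z w] by (auto simp: A_def)
  moreover have "\<gamma> 0 = z"
  proof (cases "kd z w = 0")
    case True
    then show ?thesis using \<gamma>(1)[of 0] kd_eq_0[OF z] by (auto simp: A_def)
  next
    case False
    then have "\<gamma> 0 \<in> D" "kd z (\<gamma> 0) \<le> 0" using \<gamma>(1)[of 0] kd_nonneg[of z w] by (auto simp: A_def)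
    then show ?thesis using kd_eq_0[of z "\<gamma> 0"] kd_nonneg[of z "\<gamma> 0"] z by auto
  qed
  ultimately show ?thesis using \<gamma> AD by (intro exI[of _ \<gamma>]) blast
qed

lemma geodesic: "geodesic_metric_space D kd"
  unfolding geodesic_metric_space_def
  using geodesic_segment_exists kob.Metric_space_axioms by blast

text \<open>Longer and longer segments from a fixed point that stay in one core have a limit ray.\<close>

lemma geodesic_ray_from_segments:
  assumes x: "x \<in> D" and e: "0 < e"
    and seg: "\<And>R. \<exists>L\<ge>R. \<exists>\<gamma>. \<gamma> 0 = x \<and> \<gamma> ` {0..L} \<subseteq> core e \<and>
               (\<forall>s\<in>{0..L}. \<forall>t\<in>{0..L}. kd (\<gamma> s) (\<gamma> t) = \<bar>t - s\<bar>)"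
  shows "\<exists>\<gamma>. geodesic_ray D kd \<gamma> \<and> \<gamma> ` {0..} \<subseteq> core e"
proof -
  define A where "A t = core e \<inter> {m \<in> D. kd x m \<le> t}" for t
  have "\<exists>\<gamma>. (\<forall>t\<in>{0..}. \<gamma> t \<in> A t) \<and>
     (\<forall>s\<in>{0..}. \<forall>t\<in>{0..}. kd (\<gamma> s) (\<gamma> t) = \<bar>t - s\<bar>)"
  proof (rule isometry_compactness)
    show "compact (A t)" for t unfolding A_def
      by (intro closed_Int_compact closed_core compact_kd_cball x)
    show "continuous_on (A s \<times> A t) (\<lambda>(x, y). kd x y)" for s t
      by (intro continuous_on_subset[OF continuous_on_kd]) (auto simp: A_def)
    fix F :: "real set" assume F: "finite F" "F \<subseteq> {0..}"
    obtain L \<gamma> where L: "Max (insert 0 F) \<le> L" "\<gamma> 0 = x" "\<gamma> ` {0..L} \<subseteq> core e"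
        "\<And>s t. s \<in> {0..L} \<Longrightarrow> t \<in> {0..L} \<Longrightarrow> kd (\<gamma> s) (\<gamma> t) = \<bar>t - s\<bar>"
      using seg[of "Max (insert 0 F)"] by blast
    have FL: "F \<subseteq> {0..L}" "0 \<in> {0..L}" using F L(1) by auto
    have "\<gamma> t \<in> A t" if "t \<in> F" for t
      using that FL L(2,3) L(4)[OF FL(2), of t] core_subset[OF e] by (auto simp: A_def)
    then show "\<exists>\<gamma>. (\<forall>t\<in>F. \<gamma> t \<in> A t) \<and> (\<forall>s\<in>F. \<forall>t\<in>F. kd (\<gamma> s) (\<gamma> t) = \<bar>t - s\<bar>)"
      using L(4) FL by blast
  qed
  then obtain \<gamma> where "\<And>t. 0 \<le> t \<Longrightarrow> \<gamma> t \<in> A t" "\<And>s t. 0 \<le> s \<Longrightarrow> 0 \<le> t \<Longrightarrow> kd (\<gamma> s) (\<gamma> t) = \<bar>t - s\<bar>"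
    by auto
  then show ?thesis by (intro exI[of _ \<gamma>]) (auto simp: geodesic_ray_def A_def)
qed

end

section \<open>Periodic domains: geodesics stay in a core\<close>

lemma disc_step_holomorphic_image:
  assumes "F holomorphic_on D" "F ` D \<subseteq> D'" "disc_step D z w l"
  shows "disc_step D' (F z) (F w) l"
proof -
  obtain f r where f: "f holomorphic_on ball 0 1" "f ` ball 0 1 \<subseteq> D" and r: "0 \<le> r" "r < 1"
     "f 0 = z" "f (of_real r) = w" "l = artanh r" using assms(3) unfolding disc_step_def by blast
  show ?thesis unfolding disc_step_def
    by (intro exI[of _ "F \<circ> f"] exI[of _ r] conjI holomorphic_on_compose_gen[OF f(1) assms(1) f(2)])
       (use f r assms(2) in auto)
qed

lemma disc_step_cnj:
  assumes "cnj ` D \<subseteq> D" "disc_step D z w l"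
  shows "disc_step D (cnj z) (cnj w) l"
proof -
  obtain f r where f: "f holomorphic_on ball 0 1" "f ` ball 0 1 \<subseteq> D" and r: "0 \<le> r" "r < 1"
     "f 0 = z" "f (of_real r) = w" "l = artanh r" using assms(2) unfolding disc_step_def by blast
  have b: "cnj ` ball 0 1 = ball 0 1"
    by (auto simp: image_iff intro!: bexI[of _ "cnj _"])
  have "cnj \<circ> f \<circ> cnj holomorphic_on ball 0 1"
    using f(1) by (intro holomorphic_on_compose_cnj_cnj) (auto simp: b)
  moreover have "(cnj \<circ> f \<circ> cnj) ` ball 0 1 \<subseteq> D"
    using f(2) assms(1) b by (metis image_comp image_mono order_trans)
  ultimately show ?thesis unfolding disc_step_def
    by (intro exI[of _ "cnj \<circ> f \<circ> cnj"] exI[of _ r]) (use r in auto)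
qed

lemma (in strip_domain) kd_dist_less:
  assumes z: "z \<in> D" "w \<in> D" and k: "kd z w < q" "8 * q \<le> r" "8 * q \<le> 1"
  shows "cmod (z - w) < r"
proof -
  have "min (cmod (z - w)) 1 < 8 * q" using kd_min_dist[OF z] k(1) by linarith
  then have "cmod (z - w) < 8 * q" using k(3) unfolding min_def by (simp split: if_splits)
  then show ?thesis using k(2) by linarith
qed

text \<open>Any map that carries discs to discs does not increase the distance. Stating this for links
  covers complex conjugation, which acts on discs although it is not holomorphic.\<close>

lemma (in strip_domain) kd_contraction:
  assumes "\<And>z w l. disc_step D z w l \<Longrightarrow> disc_step D (F z) (F w) l" and z: "z \<in> D" "w \<in> D"
  shows "kd (F z) (F w) \<le> kd z w"
proof (rule kd_greatest[OF z])
  fix L assume "disc_chain D z w L"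
  then have "disc_chain D (F z) (F w) L"
    by induction (auto intro: disc_chain.intros assms(1))
  then show "kd (F z) (F w) \<le> L" by (rule kobayashi_dist_le)
qed

lemma periodic_of_int:
  fixes f :: "complex \<Rightarrow> 'a"
  assumes "\<And>z. f (z + 1) = f z"
  shows "f (z + of_int n) = f z"
proof (induction n rule: int_induct[where k = 0])
  case (step1 i)
  then show ?case using assms[of "z + of_int i"] by (simp add: add.assoc)
next
  case (step2 i)
  then show ?case using assms[of "z + of_int (i - 1)"] by (simp add: algebra_simps)
qed simp

locale periodic_strip_domain = strip_domain +
  assumes shift_iff: "z + 1 \<in> D \<longleftrightarrow> z \<in> D"
begin

lemma shift_int_iff [simp]: "z + of_int n \<in> D \<longleftrightarrow> z \<in> D"
  using periodic_of_int[of "\<lambda>z. z \<in> D" z n] shift_iff by simp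

lemma kd_shift: "kd (z + 1) (w + 1) = kd z w"
proof (cases "z \<in> D \<and> w \<in> D")
  case True
  have 1: "disc_step D (z + 1) (w + 1) l" if "disc_step D z w l" for z w l
    using that by (intro disc_step_holomorphic_image[where F = "\<lambda>z. z + 1" and D = D])
      (auto intro!: holomorphic_intros simp: shift_iff)
  have 2: "disc_step D (z - 1) (w - 1) l" if "disc_step D z w l" for z w l
    using that shift_iff[of "_ - 1"]
    by (intro disc_step_holomorphic_image[where F = "\<lambda>z. z - 1" and D = D])
      (auto intro!: holomorphic_intros)
  show ?thesis
    using kd_contraction[of "\<lambda>z. z + 1" z w, OF 1] kd_contraction[of "\<lambda>z. z - 1" "z + 1" "w + 1", OF 2] True
    by (auto simp: shift_iff intro: antisym)
qed (auto simp: kobayashi_dist_def shift_iff)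

lemma kd_shift_int [simp]: "kd (z + of_int n) (w + of_int n) = kd z w"
proof -
  have "kd (u + 1) (u + 1 + (w - z)) = kd u (u + (w - z))" for u
    using kd_shift[of u "u + (w - z)"] by (simp add: add_ac)
  then have "kd (z + of_int n) (z + of_int n + (w - z)) = kd z (z + (w - z))"
    by (rule periodic_of_int)
  moreover have "z + of_int n + (w - z) = w + of_int n" "z + (w - z) = w" by simp_all
  ultimately show ?thesis by (simp only:)
qed

lemma gap_shift: "gap (z + 1) = gap z"
proof -
  have "omitted D = (\<lambda>c. c + 1) ` omitted D"
  proof (intro equalityI subsetI)
    fix c assume "c \<in> omitted D"
    then have "c - 1 \<in> omitted D" using shift_iff[of "c - 1"] by (auto simp: omitted_def)
    then show "c \<in> (\<lambda>c. c + 1) ` omitted D" by (intro image_eqI[of _ _ "c - 1"]) auto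
  qed (auto simp: omitted_def shift_iff)
  then have "gap (z + 1) = infdist (z + 1) ((\<lambda>c. c + 1) ` omitted D)" by simp
  also have "\<dots> = gap z" using omitted_ne
    by (simp add: infdist_notempty image_image)
  finally show ?thesis .
qed

lemma gap_shift_int [simp]: "gap (z + of_int n) = gap z"
  using periodic_of_int[of gap z n] gap_shift by blast

lemma core_shift_int [simp]: "z + of_int n \<in> core e \<longleftrightarrow> z \<in> core e"
  by (simp add: core_def)

lemma kd_translates:
  assumes x: "x \<in> D"
  shows "kd (x + of_int m) (x + of_int n) \<le> kd x (x + 1) * \<bar>of_int m - of_int n\<bar>"
proof -
  have *: "kd x (x + of_nat k) \<le> kd x (x + 1) * of_nat k" for k
  proof (induction k)
    case (Suc k)
    have "kd x (x + of_nat (Suc k)) \<le> kd x (x + of_nat k) + kd (x + of_nat k) (x + of_nat (Suc k))"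
      using shift_int_iff[of x "int k"] shift_int_iff[of x "int (Suc k)"] x by (intro kd_triangle) auto
    also have "kd (x + of_nat k) (x + of_nat (Suc k)) = kd x (x + 1)"
      using kd_shift_int[of x "int k" "x + 1"] by (simp add: algebra_simps)
    finally show ?case using Suc by (simp add: algebra_simps)
  qed simp
  have le: "kd (x + of_int m) (x + of_int n) \<le> kd x (x + 1) * \<bar>of_int m - of_int n\<bar>" if "m \<le> n" for m n
  proof -
    have "x + of_int n = (x + of_nat (nat (n - m))) + of_int m" using that by (simp add: of_nat_nat)
    then have "kd (x + of_int m) (x + of_int n) = kd x (x + of_nat (nat (n - m)))"
      using kd_shift_int[of x m "x + of_nat (nat (n - m))"] by (simp only:)
    then show ?thesis using *[of "nat (n - m)"] that by (simp add: of_nat_nat abs_if)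
  qed
  show ?thesis using le[of m n] le[of n m] kobayashi_dist_sym[of D "x + of_int m"]
    by (cases "m \<le> n") (auto simp: abs_minus_commute)
qed

text \<open>A path can follow the translates of \<open>x\<close>. The slope is the cost of one period at \<open>x\<close> and thus
  does not depend on \<open>e\<close>; only the additive constant does.\<close>

lemma kd_coarse_bound:
  assumes x: "x \<in> D" and e: "0 < e"
  shows "\<exists>A. \<forall>p\<in>core e. \<forall>q\<in>core e. kd p q \<le> A + kd x (x + 1) * \<bar>Re p - Re q\<bar>"
proof -
  \<comment> \<open>one period of the core, a compact set\<close>
  define K where "K = core e \<inter> {z. 0 \<le> Re z \<and> Re z \<le> 1}"
  have "bounded K"
    unfolding bounded_iff
  proof (intro exI[of _ 2] ballI)
    fix z assume "z \<in> K"
    then show "norm z \<le> 2" using cmod_le[of z] by (auto simp: K_def core_def)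
  qed
  moreover have "closed K" unfolding K_def
    by (intro closed_Int closed_core closed_Collect_conj closed_Collect_le continuous_intros)
  ultimately have "compact K" by (simp add: compact_eq_bounded_closed)
  moreover have "K \<subseteq> D" using core_subset[OF e] by (auto simp: K_def)
  ultimately have "bounded (kd x ` K)" using x
    by (intro compact_imp_bounded compact_continuous_image continuous_on_kd_comp) auto
  then obtain M where M: "\<And>y. y \<in> K \<Longrightarrow> kd x y \<le> M"
    unfolding bounded_iff by (auto simp: abs_le_iff)
  let ?B = "kd x (x + 1)"
  have near: "kd (x + of_int \<lfloor>Re p\<rfloor>) p \<le> M" if p: "p \<in> core e" for p
  proof -
    define p' where "p' = p + of_int (- \<lfloor>Re p\<rfloor>)"
    have "p' \<in> core e" unfolding p'_def using p by (simp only: core_shift_int)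
    moreover have "0 \<le> Re p'" "Re p' \<le> 1" by (simp_all add: p'_def) linarith+
    ultimately have "kd x p' \<le> M" by (intro M) (simp add: K_def)
    moreover have "p = p' + of_int \<lfloor>Re p\<rfloor>" by (simp add: p'_def)
    ultimately show ?thesis using kd_shift_int[of x "\<lfloor>Re p\<rfloor>" p'] by metis
  qed
  have "kd p q \<le> (2 * M + ?B) + ?B * \<bar>Re p - Re q\<bar>" if p: "p \<in> core e" and q: "q \<in> core e" for p q
  proof -
    let ?m = "\<lfloor>Re p\<rfloor>" and ?n = "\<lfloor>Re q\<rfloor>"
    have D: "p \<in> D" "q \<in> D" "x + of_int ?m \<in> D" "x + of_int ?n \<in> D" using p q core_subset[OF e] x by auto
    have "kd p q \<le> kd p (x + of_int ?m) + (kd (x + of_int ?m) (x + of_int ?n) + kd (x + of_int ?n) q)"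
      using kd_triangle[OF D(1,3,2)] kd_triangle[OF D(3,4,2)] by linarith
    also have "\<dots> \<le> M + (?B * \<bar>of_int ?m - of_int ?n\<bar> + M)"
      using near[OF p] near[OF q] kd_translates[OF x, of ?m ?n] kobayashi_dist_sym[of D p]
      by (intro add_mono) auto
    also have "\<bar>of_int ?m - of_int ?n\<bar> \<le> \<bar>Re p - Re q\<bar> + 1" by linarith
    then have "?B * \<bar>of_int ?m - of_int ?n\<bar> \<le> ?B * (\<bar>Re p - Re q\<bar> + 1)"
      using kd_nonneg by (intro mult_left_mono) auto
    finally show ?thesis by (simp add: algebra_simps)
  qed
  then show ?thesis by blast
qed

text \<open>The sequence \<open>p\<close> models a geodesic sampled at unit times, whose last step may be shorter; hence
  the term \<open>- 1\<close>. Consider an excursion from index \<open>i\<close> to index \<open>l\<close> on which the gap is below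
  \<open>e\<close>. Near the omitted points unit steps move by at most \<open>\<eta>\<close>, so the endpoints are within
  \<open>\<eta> (l - i)\<close> of each other, and the coarse bound gives a connection of length
  \<open>A + B \<eta> (l - i) \<le> A + (l - i) / 2\<close>, where \<open>B\<close> is the cost of one period. As \<open>p\<close> is nearly
  geodesic, \<open>l - i \<le> 2 A + 2\<close>. The order of choices matters: \<open>B\<close> first, then \<open>\<eta>\<close>, then \<open>e\<close>, and
  finally \<open>A\<close>, which depends on \<open>e\<close>.\<close>

lemma excursions_bounded:
  assumes x: "x \<in> D"
  shows "\<exists>e>0. e \<le> gap x \<and> (\<exists>R. \<forall>N p.
     (\<forall>j\<le>N. p j \<in> D) \<longrightarrow> (\<forall>j<N. kd (p j) (p (Suc j)) \<le> 1) \<longrightarrow>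
     (\<forall>i l. i \<le> l \<longrightarrow> l \<le> N \<longrightarrow> real l - real i - 1 \<le> kd (p i) (p l)) \<longrightarrow>
     e \<le> gap (p 0) \<longrightarrow> e \<le> gap (p N) \<longrightarrow>
     (\<forall>j\<le>N. \<exists>i\<le>N. e \<le> gap (p i) \<and> kd (p i) (p j) \<le> R))"
proof -
  let ?B = "kd x (x + 1)"
  define \<eta> where "\<eta> = 1 / (2 * (?B + 1))"
  have \<eta>: "0 < \<eta>" "?B * \<eta> \<le> 1 / 2"
  proof -
    have "0 < ?B + 1" using kd_nonneg[of x "x + 1"] by linarith
    then show "0 < \<eta>" "?B * \<eta> \<le> 1 / 2" by (simp_all add: \<eta>_def divide_le_eq)
  qed
  obtain e0 where e0: "0 < e0" "\<And>z w. \<lbrakk>z \<in> D; w \<in> D; gap z < e0; kd z w \<le> 1\<rbrakk> \<Longrightarrow> cmod (z - w) \<le> \<eta>"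
    using short_steps_near_omitted[OF \<eta>(1)] by blast
  define e where "e = min e0 (gap x)"
  have e: "0 < e" "e \<le> gap x" "e \<le> e0" using e0 gap_pos[OF x] by (auto simp: e_def)
  have xc: "x \<in> core e" using e x by (simp add: core_iff)
  obtain A where A: "\<And>p q. \<lbrakk>p \<in> core e; q \<in> core e\<rbrakk> \<Longrightarrow> kd p q \<le> A + ?B * \<bar>Re p - Re q\<bar>"
    using kd_coarse_bound[OF x e(1)] by blast
  have A0: "0 \<le> A" using A[OF xc xc] by simp
  have "\<exists>i\<le>N. e \<le> gap (p i) \<and> kd (p i) (p j) \<le> 2 * A + 2"
    if p: "\<And>j. j \<le> N \<Longrightarrow> p j \<in> D" and st: "\<And>j. j < N \<Longrightarrow> kd (p j) (p (Suc j)) \<le> 1"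
      and lo: "\<And>i l. i \<le> l \<Longrightarrow> l \<le> N \<Longrightarrow> real l - real i - 1 \<le> kd (p i) (p l)"
      and ends: "e \<le> gap (p 0)" "e \<le> gap (p N)" and j: "j \<le> N" for N p j
  proof (cases "e \<le> gap (p j)")
    case True
    then show ?thesis using j A0 by (intro exI[of _ j]) auto
  next
    case False
    \<comment> \<open>the last good index before \<open>j\<close> and the first good index after \<open>j\<close> bound the excursion\<close>
    define I where "I = {i. i \<le> j \<and> e \<le> gap (p i)}"
    define J where "J = {i. j \<le> i \<and> i \<le> N \<and> e \<le> gap (p i)}"
    have fin: "finite I" "I \<noteq> {}" "finite J" "J \<noteq> {}" using ends j by (auto simp: I_def J_def)
    define i where "i = Max I"
    define l where "l = Min J"
    have "i \<in> I" "l \<in> J" using fin by (auto simp: i_def l_def)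
    then have il: "i \<le> j" "e \<le> gap (p i)" "j \<le> l" "l \<le> N" "e \<le> gap (p l)" by (auto simp: I_def J_def)
    have ij: "i < j" "j < l" using il False by (metis le_neq_implies_less)+
    have inside: "gap (p k) < e" if "i < k" "k < l" for k
    proof (rule ccontr)
      assume "\<not> gap (p k) < e"
      then have "k \<in> I \<or> k \<in> J" using that il by (auto simp: I_def J_def)
      then show False using that fin by (auto simp: i_def l_def)
    qed
    have eu: "cmod (p i - p (i + k)) \<le> \<eta> * real k" if "i + k \<le> l" for k
      using that
    proof (induction k)
      case (Suc k)
      have k: "kd (p (i + k)) (p (i + Suc k)) \<le> 1" using st[of "i + k"] Suc.prems il by simp
      have D: "p (i + k) \<in> D" "p (i + Suc k) \<in> D" using p Suc.prems il by auto
      \<comment> \<open>at least one endpoint of the step lies strictly inside the excursion\<close>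
      have "cmod (p (i + k) - p (i + Suc k)) \<le> \<eta>"
      proof (cases "k = 0")
        case True
        then have "gap (p (i + Suc k)) < e0" using inside[of "i + Suc k"] ij e by simp
        then have "cmod (p (i + Suc k) - p (i + k)) \<le> \<eta>"
          using e0(2)[OF D(2,1)] k kobayashi_dist_sym by metis
        then show ?thesis by (simp add: norm_minus_commute)
      next
        case False
        then have "gap (p (i + k)) < e0" using inside[of "i + k"] Suc.prems e by simp
        then show ?thesis using e0(2)[OF D] k by simp
      qed
      moreover have "cmod (p i - p (i + Suc k)) \<le> cmod (p i - p (i + k)) + cmod (p (i + k) - p (i + Suc k))"
        using norm_triangle_ineq[of "p i - p (i + k)" "p (i + k) - p (i + Suc k)"] by simp
      ultimately show ?case using Suc by (simp add: algebra_simps)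
    qed simp
    have "\<bar>Re (p i) - Re (p l)\<bar> \<le> \<eta> * (real l - real i)"
      using eu[of "l - i"] ij abs_Re_le_cmod[of "p i - p l"] by (simp add: of_nat_diff)
    then have "?B * \<bar>Re (p i) - Re (p l)\<bar> \<le> ?B * (\<eta> * (real l - real i))"
      using kd_nonneg by (intro mult_left_mono) auto
    also have "\<dots> \<le> 1 / 2 * (real l - real i)"
      unfolding mult.assoc[symmetric] using \<eta> ij by (intro mult_right_mono) auto
    finally have drift: "2 * (?B * \<bar>Re (p i) - Re (p l)\<bar>) \<le> real l - real i" by simp
    have "p i \<in> core e" "p l \<in> core e"
      using core_iff[of "p i" e] core_iff[of "p l" e] p[of i] p[of l] il by auto
    from A[OF this] have "kd (p i) (p l) \<le> A + ?B * \<bar>Re (p i) - Re (p l)\<bar>" .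
    moreover have "real l - real i - 1 \<le> kd (p i) (p l)" using lo il by simp
    ultimately have len: "real l - real i \<le> 2 * A + 2" using drift by linarith
    have "kd (p i) (p (i + k)) \<le> real k" if "i + k \<le> N" for k
      using that
    proof (induction k)
      case (Suc k)
      then show ?case
        using kd_triangle[of "p i" "p (i + k)" "p (i + Suc k)"] st[of "i + k"] p[of i] p[of "i + k"] p[of "i + Suc k"]
        by simp
    qed simp
    from this[of "j - i"] have "kd (p i) (p j) \<le> real j - real i" using ij j by (simp add: of_nat_diff)
    then have "kd (p i) (p j) \<le> 2 * A + 2" using len ij by linarith
    then show ?thesis using il j by (intro exI[of _ i]) auto
  qed
  note near = this
  show ?thesis
  proof (rule exI[of _ e], intro conjI exI[of _ "2 * A + 2"] allI impI)
    fix N p j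
    assume a: "\<forall>j\<le>N. p j \<in> D" "\<forall>j<N. kd (p j) (p (Suc j)) \<le> 1"
      "\<forall>i l. i \<le> l \<longrightarrow> l \<le> N \<longrightarrow> real l - real i - 1 \<le> kd (p i) (p l)"
      "e \<le> gap (p 0)" "e \<le> gap (p N)" "j \<le> N"
    show "\<exists>i\<le>N. e \<le> gap (p i) \<and> kd (p i) (p j) \<le> 2 * A + 2"
      by (rule near[OF a(1)[rule_format] a(2)[rule_format] a(3)[rule_format] a(4-6)])
  qed (rule e)+
qed

text \<open>A segment from \<open>x\<close> to a translate of \<open>x\<close>, sampled at unit times, has excursions of bounded
  length only; so it stays at bounded distance from points with gap at least \<open>e\<close>, and therefore in
  a core that does not depend on the length of the segment.\<close>

lemma segments_confined:
  assumes x: "x \<in> D"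
  shows "\<exists>e>0. \<forall>n \<gamma>. \<gamma> 0 = x \<longrightarrow> \<gamma> (kd x (x + of_int n)) = x + of_int n \<longrightarrow>
      \<gamma> ` {0..kd x (x + of_int n)} \<subseteq> D \<longrightarrow>
      (\<forall>s\<in>{0..kd x (x + of_int n)}. \<forall>t\<in>{0..kd x (x + of_int n)}. kd (\<gamma> s) (\<gamma> t) = \<bar>t - s\<bar>) \<longrightarrow>
      \<gamma> ` {0..kd x (x + of_int n)} \<subseteq> core e"
proof -
  obtain e R where e: "0 < e" "e \<le> gap x" and R: "\<forall>N p. (\<forall>j\<le>N. p j \<in> D) \<longrightarrow>
     (\<forall>j<N. kd (p j) (p (Suc j)) \<le> 1) \<longrightarrow>
     (\<forall>i l. i \<le> l \<longrightarrow> l \<le> N \<longrightarrow> real l - real i - 1 \<le> kd (p i) (p l)) \<longrightarrow>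
     e \<le> gap (p 0) \<longrightarrow> e \<le> gap (p N) \<longrightarrow>
     (\<forall>j\<le>N. \<exists>i\<le>N. e \<le> gap (p i) \<and> kd (p i) (p j) \<le> R)"
    using excursions_bounded[OF x] by (elim exE conjE) (rule that)
  define e' where "e' = 2 * exp (- (exp (2 * (R + 1)) * ln ((e + 4) / e)))"
  have "\<gamma> t \<in> core e'"
    if g0: "\<gamma> 0 = x" and gL: "\<gamma> L = x + of_int n" and gD: "\<gamma> ` {0..L} \<subseteq> D"
      and iso: "\<And>s t. s \<in> {0..L} \<Longrightarrow> t \<in> {0..L} \<Longrightarrow> kd (\<gamma> s) (\<gamma> t) = \<bar>t - s\<bar>"
      and t: "t \<in> {0..L}" for \<gamma> L n t
  proof -
    define N where "N = nat \<lceil>L\<rceil>"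
    define p where "p j = \<gamma> (min (real j) L)" for j
    have L0: "0 \<le> L" using t by simp
    have N: "L \<le> real N" "real N \<le> L + 1" using L0 by (auto simp: N_def)
    have inL: "min (real j) L \<in> {0..L}" for j using L0 by auto
    define j where "j = nat \<lfloor>t\<rfloor>"
    have jt: "real j \<le> t" "t \<le> real j + 1" using t by (auto simp: j_def)
    have "j \<le> N" using jt t N by (simp add: j_def)
    have pk: "kd (p i) (p k) = \<bar>min (real k) L - min (real i) L\<bar>" for i k
      unfolding p_def by (rule iso[OF inL inL])
    obtain i where i: "i \<le> N" "e \<le> gap (p i)" "kd (p i) (p j) \<le> R"
    proof -
      have "\<exists>i\<le>N. e \<le> gap (p i) \<and> kd (p i) (p j) \<le> R"
      proof (rule R[rule_format (no_asm)])
        show "\<forall>j\<le>N. p j \<in> D" using gD inL by (auto simp: p_def)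
        show "\<forall>j<N. kd (p j) (p (Suc j)) \<le> 1" unfolding pk by (auto simp: min_def)
        show "\<forall>i l. i \<le> l \<longrightarrow> l \<le> N \<longrightarrow> real l - real i - 1 \<le> kd (p i) (p l)"
        proof (intro allI impI)
          fix i l :: nat assume "i \<le> l" "l \<le> N"
          then have "real l \<le> L + 1" "real i \<le> real l" using N by linarith+
          then show "real l - real i - 1 \<le> kd (p i) (p l)" unfolding pk by (simp add: min_def)
        qed
        show "e \<le> gap (p 0)" using e g0 L0 by (simp add: p_def)
        show "e \<le> gap (p N)" using e gL N by (simp add: p_def min_absorb2)
        show "j \<le> N" by fact
      qed
      then show ?thesis using that by blast
    qed
    have pj: "p j = \<gamma> (real j)" using jt t by (simp add: p_def min_absorb1)
    have D: "p i \<in> D" "p j \<in> D" "\<gamma> t \<in> D" using gD inL t by (auto simp: p_def)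
    have "kd (p j) (\<gamma> t) \<le> 1" unfolding pj using iso[of "real j" t] jt t by auto
    then have "kd (p i) (\<gamma> t) \<le> R + 1" using kd_triangle[OF D] i by linarith
    then have "e' \<le> gap (\<gamma> t)" unfolding e'_def by (intro gap_lower_bound[OF D(1,3) e(1) i(2)])
    then show ?thesis using D by (simp add: core_iff)
  qed
  then show ?thesis
  proof (intro exI[of _ e'] conjI allI impI image_subsetI)
    show "0 < e'" by (simp add: e'_def)
  qed blast
qed

lemma ray_in_core:
  assumes x: "x \<in> D"
  shows "\<exists>e>0. \<exists>\<gamma>. geodesic_ray D kd \<gamma> \<and> \<gamma> ` {0..} \<subseteq> core e"
proof -
  obtain e where e: "0 < e" and conf: "\<forall>n \<gamma>. \<gamma> 0 = x \<longrightarrow> \<gamma> (kd x (x + of_int n)) = x + of_int n \<longrightarrow>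
      \<gamma> ` {0..kd x (x + of_int n)} \<subseteq> D \<longrightarrow>
      (\<forall>s\<in>{0..kd x (x + of_int n)}. \<forall>t\<in>{0..kd x (x + of_int n)}. kd (\<gamma> s) (\<gamma> t) = \<bar>t - s\<bar>) \<longrightarrow>
      \<gamma> ` {0..kd x (x + of_int n)} \<subseteq> core e"
    using segments_confined[OF x] by (elim exE conjE) (rule that)
  have "\<exists>\<gamma>. geodesic_ray D kd \<gamma> \<and> \<gamma> ` {0..} \<subseteq> core e"
  proof (rule geodesic_ray_from_segments[OF x e])
    fix R
    have "bounded {w \<in> D. kd x w \<le> R}" using compact_kd_cball[OF x] compact_imp_bounded by blast
    then obtain b where b: "\<And>w. w \<in> D \<Longrightarrow> kd x w \<le> R \<Longrightarrow> cmod w \<le> b"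
      unfolding bounded_iff by auto
    define n where "n = \<lceil>b + cmod x\<rceil> + 1"
    have "b + cmod x < of_int n" by (simp add: n_def) linarith
    also have "\<dots> \<le> cmod (of_int n)" by (simp add: norm_of_int)
    also have "\<dots> \<le> cmod (x + of_int n) + cmod x" using norm_triangle_ineq4[of "x + of_int n" x] by simp
    finally have "R \<le> kd x (x + of_int n)" using b[of "x + of_int n"] x by force
    moreover obtain \<gamma> where \<gamma>: "\<gamma> ` {0..kd x (x + of_int n)} \<subseteq> D" "\<gamma> 0 = x" "\<gamma> (kd x (x + of_int n)) = x + of_int n"
       "\<forall>s\<in>{0..kd x (x + of_int n)}. \<forall>t\<in>{0..kd x (x + of_int n)}. kd (\<gamma> s) (\<gamma> t) = \<bar>t - s\<bar>"
      using geodesic_segment_exists[of x "x + of_int n"] x by auto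
    ultimately show "\<exists>L\<ge>R. \<exists>\<gamma>. \<gamma> 0 = x \<and> \<gamma> ` {0..L} \<subseteq> core e \<and>
               (\<forall>s\<in>{0..L}. \<forall>t\<in>{0..L}. kd (\<gamma> s) (\<gamma> t) = \<bar>t - s\<bar>)"
      using conf[rule_format (no_asm), OF \<gamma>(2,3,1,4)] \<gamma>(2,4) by blast
  qed
  then show ?thesis using e by blast
qed

end

section \<open>Symmetric periodic domains: conjugate rays\<close>

locale symmetric_periodic_strip_domain = periodic_strip_domain +
  assumes cnj_iff: "cnj z \<in> D \<longleftrightarrow> z \<in> D"
begin

lemma kd_cnj: "z \<in> D \<Longrightarrow> w \<in> D \<Longrightarrow> kd (cnj z) (cnj w) = kd z w"
proof -
  assume z: "z \<in> D" "w \<in> D"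
  have 1: "disc_step D (cnj z) (cnj w) l" if "disc_step D z w l" for z w l
    using disc_step_cnj[OF _ that] cnj_iff by blast
  show ?thesis
    using kd_contraction[of cnj z w, OF 1] kd_contraction[of cnj "cnj z" "cnj w", OF 1] z
    by (auto simp: cnj_iff intro: antisym)
qed

lemma gap_cnj: "gap (cnj z) = gap z"
proof -
  have "omitted D = cnj ` omitted D"
  proof (intro equalityI subsetI)
    fix c assume "c \<in> omitted D"
    then have "cnj c \<in> omitted D" by (auto simp: omitted_def cnj_iff)
    then show "c \<in> cnj ` omitted D" by (intro image_eqI[of _ _ "cnj c"]) auto
  qed (auto simp: omitted_def cnj_iff)
  then have "gap (cnj z) = infdist (cnj z) (cnj ` omitted D)" by simp
  also have "\<dots> = gap z"
  proof -
    have "dist (cnj z) (cnj c) = dist z c" for c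
      by (metis complex_cnj_diff complex_mod_cnj dist_norm)
    then show ?thesis using omitted_ne by (simp add: infdist_notempty image_image)
  qed
  finally show ?thesis .
qed

text \<open>The second ray is the complex conjugate of the first. They are asymptotic by the coarse bound,
  since \<open>\<gamma> t\<close> and its conjugate have the same real part. If they were strongly asymptotic with
  shift \<open>T\<close>, then going from \<open>\<gamma> t\<close> to \<open>\<sigma> (t + T)\<close> and on to \<open>\<gamma> (t + 2 T)\<close> would show that
  \<open>kd (\<gamma> t) (\<gamma> (t + 2 T))\<close> tends to \<open>0\<close>, so \<open>T = 0\<close> and \<open>\<gamma>\<close> would approach the real axis.
  But \<open>\<gamma>\<close> crosses vertical lines through translates of \<open>c\<close> arbitrarily late, and there it would come too close to these omitted points.\<close>

lemma not_approaching_of_ray_in_core: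
  assumes ray: "geodesic_ray D kd \<gamma>" and e: "0 < e" and core: "\<gamma> ` {0..} \<subseteq> core e"
    and c: "c \<in> \<real>" "\<And>n. c + of_int n \<notin> D"
  shows "\<not> approaching_geodesics D kd"
proof
  assume app: "approaching_geodesics D kd"
  define \<sigma> where "\<sigma> = cnj \<circ> \<gamma>"
  have core_cnj: "z \<in> core e \<Longrightarrow> cnj z \<in> core e" for z by (simp add: core_def gap_cnj)
  have gD: "\<gamma> t \<in> D" "\<gamma> t \<in> core e" "\<sigma> t \<in> D" "\<sigma> t \<in> core e" if "0 \<le> t" for t
  proof -
    show *: "\<gamma> t \<in> core e" using core that by blast
    then show **: "\<sigma> t \<in> core e" using core_cnj by (simp add: \<sigma>_def)
    show "\<gamma> t \<in> D" "\<sigma> t \<in> D" using * ** core_subset[OF e] by blast+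
  qed
  have iso: "kd (\<gamma> s) (\<gamma> t) = \<bar>t - s\<bar>" if "0 \<le> s" "0 \<le> t" for s t
    using ray that by (simp add: geodesic_ray_def)
  have \<sigma>\<sigma>: "kd (\<sigma> s) (\<sigma> t) = kd (\<gamma> s) (\<gamma> t)" if "0 \<le> s" "0 \<le> t" for s t
    using kd_cnj[OF gD(1)[OF that(1)] gD(1)[OF that(2)]] by (simp add: \<sigma>_def)
  have \<gamma>\<sigma>: "kd (\<sigma> s) (\<gamma> t) = kd (\<gamma> s) (\<sigma> t)" if "0 \<le> s" "0 \<le> t" for s t
    using kd_cnj[OF gD(1)[OF that(1)] gD(3)[OF that(2)]] by (simp add: \<sigma>_def)
  have "geodesic_ray D kd \<sigma>"
    unfolding geodesic_ray_def
  proof (intro conjI allI impI image_subsetI)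
    show "\<sigma> t \<in> D" if "t \<in> {0..}" for t using that gD(3) by simp
    show "kd (\<sigma> s) (\<sigma> t) = \<bar>t - s\<bar>" if "0 \<le> s" "0 \<le> t" for s t
      using iso[OF that] \<sigma>\<sigma>[OF that] by simp
  qed
  obtain A where A: "\<And>p q. \<lbrakk>p \<in> core e; q \<in> core e\<rbrakk> \<Longrightarrow>
      kd p q \<le> A + kd (\<gamma> 0) (\<gamma> 0 + 1) * \<bar>Re p - Re q\<bar>"
    using kd_coarse_bound[OF gD(1)[of 0] e] by auto
  have "kd (\<gamma> t) (\<sigma> t) \<le> A" if "0 \<le> t" for t
    using A[OF gD(2,4)[OF that]] by (simp add: \<sigma>_def)
  then have "asymptotic_rays kd \<gamma> \<sigma>"
    unfolding asymptotic_rays_def by (intro bdd_aboveI[of _ A]) auto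
  then have "strongly_asymptotic_rays kd \<gamma> \<sigma>"
    using app ray \<open>geodesic_ray D kd \<sigma>\<close> unfolding approaching_geodesics_def by blast
  then obtain T where T: "((\<lambda>t. kd (\<gamma> t) (\<sigma> (t + T))) \<longlongrightarrow> 0) at_top"
    unfolding strongly_asymptotic_rays_def by blast
  have "T = 0"
  proof -
    have "((\<lambda>t. kd (\<gamma> (t + T)) (\<sigma> (t + T + T))) \<longlongrightarrow> 0) at_top"
      by (rule filterlim_compose[OF T]) (rule filterlim_tendsto_add_at_top[OF tendsto_const filterlim_ident, of T, simplified add.commute])
    from tendsto_add[OF T this]
    have "((\<lambda>t. kd (\<gamma> t) (\<sigma> (t + T)) + kd (\<gamma> (t + T)) (\<sigma> (t + T + T))) \<longlongrightarrow> 0) at_top" by simp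
    moreover have "\<forall>\<^sub>F t in at_top. \<bar>2 * T\<bar> \<le> kd (\<gamma> t) (\<sigma> (t + T)) + kd (\<gamma> (t + T)) (\<sigma> (t + T + T))"
      using eventually_ge_at_top[of "2 * \<bar>T\<bar>"]
    proof eventually_elim
      case (elim t)
      then have t: "0 \<le> t" "0 \<le> t + T" "0 \<le> t + T + T" by linarith+
      have "\<bar>2 * T\<bar> = kd (\<gamma> t) (\<gamma> (t + T + T))" using iso[OF t(1,3)] by simp
      also have "\<dots> \<le> kd (\<gamma> t) (\<sigma> (t + T)) + kd (\<sigma> (t + T)) (\<gamma> (t + T + T))"
        by (rule kd_triangle[OF gD(1)[OF t(1)] gD(3)[OF t(2)] gD(1)[OF t(3)]])
      finally show ?case using \<gamma>\<sigma>[OF t(2,3)] by simp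
    qed
    ultimately have "\<bar>2 * T\<bar> \<le> 0"
      using tendsto_lowerbound trivial_limit_at_top_linorder by blast
    then show ?thesis by simp
  qed
  define \<delta> where "\<delta> = min e 1 / 8"
  have \<delta>: "0 < \<delta>" "8 * \<delta> \<le> e" "8 * \<delta> \<le> 1" using e by (auto simp: \<delta>_def)
  have "\<forall>\<^sub>F t in at_top. kd (\<gamma> t) (\<sigma> t) < \<delta>"
    using order_tendstoD(2)[OF T \<delta>(1)] unfolding \<open>T = 0\<close> add_0_right .
  then obtain t0 where t0: "\<And>t. t0 \<le> t \<Longrightarrow> kd (\<gamma> t) (\<sigma> t) < \<delta>"
    unfolding eventually_at_top_linorder by blast
  define t1 where "t1 = max 0 t0"
  have Im: "\<bar>Im (\<gamma> t)\<bar> < e" if "t1 \<le> t" for t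
  proof -
    have t: "0 \<le> t" "t0 \<le> t" using that by (auto simp: t1_def)
    have "cmod (\<gamma> t - \<sigma> t) < e"
      by (rule kd_dist_less[OF gD(1)[OF t(1)] gD(3)[OF t(1)] t0[OF t(2)] \<delta>(2,3)])
    moreover have "\<bar>2 * Im (\<gamma> t)\<bar> \<le> cmod (\<gamma> t - \<sigma> t)"
      using abs_Im_le_cmod[of "\<gamma> t - \<sigma> t"] by (simp add: \<sigma>_def)
    ultimately show ?thesis by linarith
  qed
  have cont: "continuous_on {0..} \<gamma>"
    unfolding continuous_on_iff
  proof (intro ballI allI impI)
    fix s r :: real assume s: "s \<in> {0..}" and r: "0 < r"
    define q where "q = min r 1 / 8"
    have q: "0 < q" "8 * q \<le> r" "8 * q \<le> 1" using r by (auto simp: q_def)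
    have "dist (\<gamma> t) (\<gamma> s) < r" if t: "t \<in> {0..}" "dist t s < q" for t
    proof -
      have "kd (\<gamma> t) (\<gamma> s) < q" using iso[of t s] s t by (simp add: dist_norm abs_minus_commute)
      then have "cmod (\<gamma> t - \<gamma> s) < r"
        using s t q(2,3) by (intro kd_dist_less[where q = q] gD(1)) auto
      then show ?thesis by (simp add: dist_norm)
    qed
    then show "\<exists>d>0. \<forall>t\<in>{0..}. dist t s < d \<longrightarrow> dist (\<gamma> t) (\<gamma> s) < r"
      using q(1) by blast
  qed
  let ?B = "kd (\<gamma> 0) (\<gamma> 0 + 1)"
  \<comment> \<open>so late that the coarse bound forces the real part to change by more than \<open>2\<close> between \<open>t1\<close> and \<open>t2\<close>\<close>
  define t2 where "t2 = t1 + A + ?B * 2 + 1"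
  have "0 \<le> A" using A[OF gD(2) gD(2), of 0 0] by simp
  then have t2: "0 \<le> t1" "t1 \<le> t2" using kd_nonneg[of "\<gamma> 0" "\<gamma> 0 + 1"] unfolding t2_def t1_def by linarith+
  have far: "2 < \<bar>Re (\<gamma> t1) - Re (\<gamma> t2)\<bar>"
  proof (rule ccontr)
    assume "\<not> ?thesis"
    then have "?B * \<bar>Re (\<gamma> t1) - Re (\<gamma> t2)\<bar> \<le> ?B * 2"
      using kd_nonneg by (intro mult_left_mono) auto
    then have "kd (\<gamma> t1) (\<gamma> t2) \<le> A + ?B * 2" using A[OF gD(2) gD(2), of t1 t2] t2 by linarith
    moreover have "kd (\<gamma> t1) (\<gamma> t2) = t2 - t1" using iso[of t1 t2] t2 by linarith
    ultimately show False by (simp add: t2_def)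
  qed
  define a where "a = min (Re (\<gamma> t1)) (Re (\<gamma> t2))"
  define b where "b = max (Re (\<gamma> t1)) (Re (\<gamma> t2))"
  have ab: "a + 2 < b" using far unfolding a_def b_def by (cases "Re (\<gamma> t1) \<le> Re (\<gamma> t2)") auto
  \<comment> \<open>a translate of \<open>c\<close> with real part between those of \<open>\<gamma> t1\<close> and \<open>\<gamma> t2\<close>\<close>
  define n where "n = \<lceil>a - Re c\<rceil>"
  define y where "y = Re c + of_int n"
  have "a - Re c \<le> of_int n" "of_int n < a - Re c + 1"
    using ceiling_correct[of "a - Re c"] by (simp_all add: n_def)
  then have y: "a \<le> y" "y \<le> b" using ab by (simp_all add: y_def)
  have cR: "continuous_on {t1..t2} (\<lambda>t. Re (\<gamma> t))"
    using t2 by (intro continuous_intros continuous_on_subset[OF cont]) auto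
  have "\<exists>t\<ge>t1. t \<le> t2 \<and> Re (\<gamma> t) = y"
  proof (cases "Re (\<gamma> t1) \<le> Re (\<gamma> t2)")
    case True
    then have "Re (\<gamma> t1) \<le> y" "y \<le> Re (\<gamma> t2)" using y by (simp_all add: a_def b_def)
    then show ?thesis using IVT'[of "\<lambda>t. Re (\<gamma> t)", OF _ _ t2(2) cR] by blast
  next
    case False
    then have "Re (\<gamma> t2) \<le> y" "y \<le> Re (\<gamma> t1)" using y by (simp_all add: a_def b_def)
    then show ?thesis using IVT2'[of "\<lambda>t. Re (\<gamma> t)", OF _ _ t2(2) cR] by blast
  qed
  then obtain t where t: "t1 \<le> t" "t \<le> t2" "Re (\<gamma> t) = Re c + of_int n" unfolding y_def by blast
  have Imc: "Im c = 0" using c(1) by (simp add: complex_is_Real_iff)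
  then have "c + of_int n \<in> omitted D" using c by (auto simp: omitted_def)
  then have "gap (\<gamma> t) \<le> dist (\<gamma> t) (c + of_int n)" by (rule infdist_le)
  moreover have "\<gamma> t - (c + of_int n) = \<i> * of_real (Im (\<gamma> t))"
    using t Imc by (simp add: complex_eq_iff)
  then have "dist (\<gamma> t) (c + of_int n) = \<bar>Im (\<gamma> t)\<bar>" by (simp add: dist_norm norm_mult)
  ultimately have "gap (\<gamma> t) < e" using Im[OF t(1)] by simp
  moreover have "0 \<le> t" using t t2 by linarith
  then have "e \<le> gap (\<gamma> t)" using gD(2) unfolding core_def by blast
  ultimately show False by linarith
qed

end

theorem proposition5p2:
  fixes S C D :: "complex set" and i h :: "complex \<Rightarrow> complex"
  defines "S \<equiv> {z. \<bar>Im z\<bar> < 1}"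
    and "i \<equiv> (\<lambda>z. cnj z)"
    and "h \<equiv> (\<lambda>z. z + 1)"
    and "D \<equiv> S - C"
  assumes "closed C" and "C \<subseteq> S"
    and "i ` C = C" and "h ` C = C"
    and "C \<inter> \<real> \<noteq> {}"
    and "connected D"
  shows "proper_metric_space D (kobayashi_dist D) \<and>
         geodesic_metric_space D (kobayashi_dist D) \<and>
         \<not> approaching_geodesics D (kobayashi_dist D)"
proof -
  have shift: "z + 1 \<in> C \<longleftrightarrow> z \<in> C" for z
  proof
    assume "z + 1 \<in> C"
    then have "h z \<in> h ` C" using \<open>h ` C = C\<close> by (simp add: h_def)
    then show "z \<in> C" by (auto simp: h_def)
  next
    assume "z \<in> C"
    then have "h z \<in> h ` C" by blast
    then show "z + 1 \<in> C" using \<open>h ` C = C\<close> by (simp add: h_def)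
  qed
  have conj: "cnj z \<in> C \<longleftrightarrow> z \<in> C" for z
  proof
    assume "cnj z \<in> C"
    then have "i z \<in> i ` C" using \<open>i ` C = C\<close> by (simp add: i_def)
    then show "z \<in> C" by (auto simp: i_def)
  next
    assume "z \<in> C"
    then have "i z \<in> i ` C" by blast
    then show "cnj z \<in> C" using \<open>i ` C = C\<close> by (simp add: i_def)
  qed
  have "open S" unfolding S_def by (intro open_Collect_less continuous_intros)
  then interpret symmetric_periodic_strip_domain D
    using \<open>closed C\<close> \<open>connected D\<close>
    by unfold_locales (auto simp: D_def S_def shift conj)
  obtain c where c: "c \<in> C" "c \<in> \<real>" using \<open>C \<inter> \<real> \<noteq> {}\<close> by blast
  have "c + of_int n \<notin> D" for n
    using periodic_of_int[of "\<lambda>z. z \<in> C" c n] shift c by (simp add: D_def)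
  moreover have "D \<noteq> {}"
  proof
    assume "D = {}"
    then have "C = S" using \<open>C \<subseteq> S\<close> unfolding D_def by blast
    then have "C = {} \<or> C = UNIV" using \<open>open S\<close> \<open>closed C\<close> clopen[of C] by simp
    moreover have "\<i> \<notin> S" by (simp add: S_def)
    ultimately show False using c \<open>C = S\<close> by auto
  qed
  then obtain x where "x \<in> D" by blast
  then obtain e \<gamma> where "0 < e" "geodesic_ray D kd \<gamma>" "\<gamma> ` {0..} \<subseteq> core e"
    using ray_in_core by blast
  ultimately have "\<not> approaching_geodesics D kd" using not_approaching_of_ray_in_core c by blast
  then show ?thesis using proper geodesic by blast
qed

end
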